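(* Let $\mathcal F$ be a class of Borel measurable real functions on a topological space $S$ with a finite envelope $F$. For a given $\mu\in\mathcal P(S)$, let $\delta$ be a map from $\mathcal P_0\subset\mathcal P(S)$ into a Banach space $(\mathfrak E,\|\cdot\|_{\mathfrak E})$, where $\mathcal P_0$ is a convex subset such that $\mu\in\mathcal P_0$ and $\int F\,d\nu<\infty$ for all $\nu\in\mathcal P_0$. Suppose that (a) $\mu_n:\Omega\to\mathcal P_0$, $n\in\mathbb N$, are random probability measures with values in $\mathcal P_0$ such that there exists a tight random variable $G_\mu$ in $\ell^\infty(\mathcal F)$ with $\sqrt n(\mu_n-\mu)\stackrel{d}{\to}G_\mu$ in $\ell^\infty(\mathcal F)$; (b) there exist constants $\epsilon>0$ and $C<\infty$ such that, for $\nu,\nu'\in\mathcal P_0$, $\|\nu-\mu\|_{\infty,\mathcal F}\vee\|\nu'-\mu\|_{\infty,\mathcal F}<\epsilon$ implies $\|\delta(\nu)-\delta(\nu')\|_{\mathfrak E}\le C\|\nu-\nu'\|_{\infty,\mathcal F}$; (c) for every $\nu\in\mathcal P_0$, the mapping $t\mapsto\delta(\mu+t(\nu-\mu))$ is right differentiable at $t=0$, with right derivative $\delta'_\mu(\nu-\mu)=\lim_{t\downarrow0}t^{-1}\{\delta(\mu+t(\nu-\mu))-\delta(\mu)\}$. Denote again by $\delta'_\mu$ its unique continuous, positively homogeneous extension to $\mathcal T_{\mathcal P_0}(\mu)$. If, in addition, $G_\mu$ is a mean-zero Gaussian variable in $\ell^\infty(\mathcal F)$, then $\mathrm{spt}(G_\mu)$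 is a vector subspace of $\ell^\infty(\mathcal F)$. If further $\delta'_\mu$ is linear on $\mathrm{spt}(G_\mu)$, then $\nu\mapsto\delta(\nu)$ is Hadamard differentiable with respect to $\|\cdot\|_{\infty,\mathcal F}$ at $\nu=\mu$ tangentially to $\mathrm{spt}(G_\mu)$.
   Context: $\mathcal P(S)$ is the set of Borel probability measures on $S$. An envelope of $\mathcal F$ is a measurable $F\ge0$ with $|f|\le F$ for all $f\in\mathcal F$. $\ell^\infty(\mathcal F)$ is the Banach space of bounded real functions on $\mathcal F$ with sup-norm $\|\cdot\|_{\infty,\mathcal F}$. A finite signed measure $\gamma$ integrating $F$ is identified with $f\mapsto\int f\,d\gamma$ in $\ell^\infty(\mathcal F)$. $\mathcal T_{\mathcal P_0}(\mu)$ is the closure in $\ell^\infty(\mathcal F)$ of $\{t(\nu-\mu):\nu\in\mathcal P_0,t>0\}$; under (a)-(c), $\delta'_\mu$ extends uniquely to a continuous positively homogeneous map on $\mathcal T_{\mathcal P_0}(\mu)$ and $G_\mu\in\mathcal T_{\mathcal P_0}(\mu)$ a.s. Convergence in distribution is in the sense of Hoffmann-Jørgensen when necessary. $\mathrm{spt}(G_\mu)$ is the topological support of the law of $G_\mu$. Hadamard differentiability: a map $\phi:\Theta\subset\mathfrak D\to\mathfrak E$ between normed spaces is Hadamard differentiable at $\theta\in\Theta$ tangentially to a vector subspace $\mathfrak D_0\subset\mathfrak D$ if there is a continuous linear map $\phi'_\theta:\mathfrak D_0\to\mathfrak E$ with $\lim_n t_n^{-1}\{\phi(\theta+t_nh_n)-\phi(\theta)\}=\phi'_\theta(h)$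 for all $h\in\mathfrak D_0$, $t_n\to0$ with $t_n\neq0$, and $h_n\to h$ in $\mathfrak D$ with $\theta+t_nh_n\in\Theta$. Here $\delta$ is viewed as a map on a subset of $\ell^\infty(\mathcal F)$: with $\tau\nu=(f\mapsto\nu(f))$ and $\mathcal P_{0,\epsilon}=\{\nu\in\mathcal P_0:\|\nu-\mu\|_{\infty,\mathcal F}<\epsilon\}$ ($\epsilon$ from (b)), one identifies $\delta$ with $\bar\delta:\tau\mathcal P_{0,\epsilon}\to\mathfrak E$, $\bar\delta(\tau\nu)=\delta(\nu)$, which is well defined by (b), and $\mu$ with $\tau\mu$. *)

theory Defs
  imports "HOL-Probability.Probability"
begin

text \<open>On a discrete space every function is continuous, so this is the Banach space of all
  bounded real functions on the type \<open>'i\<close>, with the supremum norm.\<close>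

type_synonym 'i linf = "'i discrete \<Rightarrow>\<^sub>C real"

text \<open>The space of bounded functions on a subset \<open>I\<close> of the type, realised isometrically as
  the closed subspace of those bounded functions that vanish outside \<open>I\<close>.\<close>

definition linf_on :: "'i set \<Rightarrow> 'i linf set" where
  "linf_on I = {x. \<forall>i. i \<notin> I \<longrightarrow> apply_bcontfun x (discrete i) = 0}"

definition borel_prob :: "'s::topological_space measure set" where
  "borel_prob = {\<nu>. prob_space \<nu> \<and> sets \<nu> = sets borel}"

definition envelope :: "('s::topological_space \<Rightarrow> real) set \<Rightarrow> ('s \<Rightarrow> real) \<Rightarrow> bool" where
  "envelope \<F> F \<longleftrightarrow> F \<in> borel_measurable borel \<and> (\<forall>x. 0 \<le> F x) \<and> (\<forall>f\<in>\<F>. \<forall>x. \<bar>f x\<bar> \<le> F x)"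

text \<open>The functional \<open>f \<mapsto> \<integral> f d\<nu>\<close> on the class \<open>\<F>\<close>. It is bounded on \<open>\<F>\<close> whenever the envelope
  is \<open>\<nu>\<close>-integrable; \<open>Bcontfun\<close> is only meaningful in that case.\<close>

definition emb :: "('s \<Rightarrow> real) set \<Rightarrow> 's measure \<Rightarrow> ('s \<Rightarrow> real) linf" where
  "emb \<F> \<nu> = Bcontfun (\<lambda>d. if of_discrete d \<in> \<F> then \<integral>x. of_discrete d x \<partial>\<nu> else 0)"

lemma emb_apply:
  assumes \<nu>: "\<nu> \<in> borel_prob" and meas: "\<F> \<subseteq> borel_measurable borel"
    and env: "envelope \<F> F" and int: "integrable \<nu> F"
  shows "apply_bcontfun (emb \<F> \<nu>) (discrete f) = (if f \<in> \<F> then \<integral>x. f x \<partial>\<nu> else 0)"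
proof -
  let ?g = "\<lambda>d. if of_discrete d \<in> \<F> then \<integral>x. of_discrete d x \<partial>\<nu> else 0"
  have pos: "0 \<le> (\<integral>x. F x \<partial>\<nu>)"
    using env by (auto simp: envelope_def)
  have bnd: "\<bar>\<integral>x. f x \<partial>\<nu>\<bar> \<le> (\<integral>x. F x \<partial>\<nu>)" if "f \<in> \<F>" for f
  proof -
    have "f \<in> borel_measurable \<nu>"
      using that meas \<nu> measurable_cong_sets[of \<nu> borel borel borel] by (auto simp: borel_prob_def)
    then have "integrable \<nu> f"
      using Bochner_Integration.integrable_bound[OF int] env that by (fastforce simp: envelope_def)
    then have "(\<integral>x. \<bar>f x\<bar> \<partial>\<nu>) \<le> (\<integral>x. F x \<partial>\<nu>)"
      using env that int
      by (intro Bochner_Integration.integral_mono integrable_abs) (auto simp: envelope_def)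
    then show ?thesis
      using integral_abs_bound[of \<nu> f] by linarith
  qed
  have "?g \<in> bcontfun"
    unfolding bcontfun_def
  proof (intro CollectI conjI)
    show "continuous_on UNIV ?g"
      by (simp add: continuous_on_open_vimage open_discrete)
    show "bounded (range ?g)"
      unfolding bounded_iff using bnd pos by (intro exI[of _ "\<integral>x. F x \<partial>\<nu>"]) auto
  qed
  then show ?thesis
    by (simp add: emb_def Bcontfun_inverse discrete_inverse)
qed

text \<open>The measure \<open>\<mu> + t (\<nu> - \<mu>)\<close>, for \<open>0 \<le> t \<le> 1\<close>.\<close>

definition mixture :: "real \<Rightarrow> 's::topological_space measure \<Rightarrow> 's measure \<Rightarrow> 's measure" where
  "mixture t \<mu> \<nu> = measure_of UNIV (sets borel)
     (\<lambda>A. ennreal (1 - t) * emeasure \<mu> A + ennreal t * emeasure \<nu> A)"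

lemma emeasure_mixture:
  assumes "\<mu> \<in> borel_prob" "\<nu> \<in> borel_prob" "A \<in> sets borel"
  shows "emeasure (mixture t \<mu> \<nu>) A = ennreal (1 - t) * emeasure \<mu> A + ennreal t * emeasure \<nu> A"
proof -
  have s: "sets \<mu> = sets borel" "sets \<nu> = sets borel"
    using assms by (auto simp: borel_prob_def)
  show ?thesis
    unfolding mixture_def
  proof (rule emeasure_measure_of_sigma)
    show "sigma_algebra UNIV (sets borel :: 'a set set)"
      by (metis sets.sigma_algebra_axioms space_borel)
    show "positive (sets borel)
      (\<lambda>A. ennreal (1 - t) * emeasure \<mu> A + ennreal t * emeasure \<nu> A)"
      by (simp add: positive_def)
    show "countably_additive (sets borel)
      (\<lambda>A. ennreal (1 - t) * emeasure \<mu> A + ennreal t * emeasure \<nu> A)"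
      by (auto simp: countably_additive_def s suminf_emeasure suminf_add[symmetric]
          ennreal_suminf_cmult)
  qed (rule assms)
qed

definition convex_measures :: "'s::topological_space measure set \<Rightarrow> bool" where
  "convex_measures P \<longleftrightarrow> (\<forall>\<mu>\<in>P. \<forall>\<nu>\<in>P. \<forall>t\<in>{0..1}. mixture t \<mu> \<nu> \<in> P)"

definition tight_rv :: "'w measure \<Rightarrow> ('w \<Rightarrow> 'd::metric_space) \<Rightarrow> bool" where
  "tight_rv N G \<longleftrightarrow> G \<in> borel_measurable N \<and>
     (\<forall>e>0. \<exists>K. compact K \<and> measure (distr N borel G) K \<ge> 1 - e)"

text \<open>Outer expectation of a bounded, possibly non-measurable, function on a probability space.\<close>

definition outer_expectation :: "'w measure \<Rightarrow> ('w \<Rightarrow> real) \<Rightarrow> real" where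
  "outer_expectation M Z =
     Inf {integral\<^sup>L M U | U. integrable M U \<and> (\<forall>w\<in>space M. Z w \<le> U w)}"

text \<open>Convergence in distribution, in the sense of Hoffmann-Joergensen, of arbitrary maps
  \<open>X n\<close> from a probability space \<open>M\<close> into \<open>D\<close> to a Borel measurable \<open>G\<close> defined on a possibly
  different probability space \<open>N\<close>.\<close>

definition hj_converges ::
  "'d::metric_space set \<Rightarrow> 'w measure \<Rightarrow> (nat \<Rightarrow> 'w \<Rightarrow> 'd) \<Rightarrow> 'v measure \<Rightarrow> ('v \<Rightarrow> 'd) \<Rightarrow> bool" where
  "hj_converges D M X N G \<longleftrightarrow>
     (\<forall>h :: 'd \<Rightarrow> real. continuous_on D h \<and> bounded (h ` D) \<longrightarrow>
        (\<lambda>n. outer_expectation M (\<lambda>w. h (X n w))) \<longlonglongrightarrow> (\<integral>v. h (G v) \<partial>N))"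

text \<open>Every continuous linear functional of \<open>G\<close> has a centred normal distribution, where point
  mass at 0 counts as the normal distribution of variance 0. For \<open>G\<close> with values in a
  subspace such as \<^term>\<open>linf_on I\<close>, quantifying over the functionals on the ambient space is the
  same as quantifying over those on the subspace, since the latter extend.\<close>

definition centered_gaussian :: "'v measure \<Rightarrow> ('v \<Rightarrow> 'd::real_normed_vector) \<Rightarrow> bool" where
  "centered_gaussian N G \<longleftrightarrow> G \<in> borel_measurable N \<and>
     (\<forall>L :: 'd \<Rightarrow> real. bounded_linear L \<longrightarrow>
        (\<exists>\<sigma>\<ge>0. distr N borel (\<lambda>v. L (G v)) =
           (if \<sigma> = 0 then return borel 0 else density lborel (\<lambda>x. ennreal (normal_density 0 \<sigma> x)))))"

definition top_support :: "'d::topological_space measure \<Rightarrow> 'd set" where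
  "top_support Q = {x. \<forall>U. open U \<and> x \<in> U \<longrightarrow> emeasure Q U > 0}"

definition spt :: "'v measure \<Rightarrow> ('v \<Rightarrow> 'd::topological_space) \<Rightarrow> 'd set" where
  "spt N G = top_support (distr N borel G)"

definition tangent_cone ::
  "('s \<Rightarrow> real) set \<Rightarrow> 's measure set \<Rightarrow> 's measure \<Rightarrow> ('s \<Rightarrow> real) linf set" where
  "tangent_cone \<F> P0 \<mu> = closure {t *\<^sub>R (emb \<F> \<nu> - emb \<F> \<mu>) | t \<nu>. \<nu> \<in> P0 \<and> t > 0}"

definition has_right_derivative ::
  "('s::topological_space measure \<Rightarrow> 'e::real_normed_vector) \<Rightarrow> 's measure \<Rightarrow> 's measure \<Rightarrow> 'e \<Rightarrow> bool"
where
  "has_right_derivative \<delta> \<mu> \<nu> d \<longleftrightarrow>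
     ((\<lambda>t. (1 / t) *\<^sub>R (\<delta> (mixture t \<mu> \<nu>) - \<delta> \<mu>)) \<longlongrightarrow> d) (at_right 0)"

text \<open>Continuous, positively homogeneous extensions of the right derivative
  \<open>\<nu> - \<mu> \<mapsto> \<delta>'\<^sub>\<mu>(\<nu> - \<mu>)\<close> to the tangent cone; membership in \<^const>\<open>extensional\<close> only fixes the
  irrelevant values off the cone, so that uniqueness can hold.\<close>

definition is_derivative_extension ::
  "('s::topological_space \<Rightarrow> real) set \<Rightarrow> 's measure set \<Rightarrow> ('s measure \<Rightarrow> 'e::real_normed_vector) \<Rightarrow>
   's measure \<Rightarrow> (('s \<Rightarrow> real) linf \<Rightarrow> 'e) \<Rightarrow> bool"
where
  "is_derivative_extension \<F> P0 \<delta> \<mu> D \<longleftrightarrow>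
     D \<in> extensional (tangent_cone \<F> P0 \<mu>) \<and>
     continuous_on (tangent_cone \<F> P0 \<mu>) D \<and>
     (\<forall>x\<in>tangent_cone \<F> P0 \<mu>. \<forall>t>0. D (t *\<^sub>R x) = t *\<^sub>R D x) \<and>
     (\<forall>\<nu>\<in>P0. has_right_derivative \<delta> \<mu> \<nu> (D (emb \<F> \<nu> - emb \<F> \<mu>)))"

definition derivative_extension ::
  "('s::topological_space \<Rightarrow> real) set \<Rightarrow> 's measure set \<Rightarrow> ('s measure \<Rightarrow> 'e::real_normed_vector) \<Rightarrow>
   's measure \<Rightarrow> ('s \<Rightarrow> real) linf \<Rightarrow> 'e"
where
  "derivative_extension \<F> P0 \<delta> \<mu> = (THE D. is_derivative_extension \<F> P0 \<delta> \<mu> D)"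

definition linear_on_subspace ::
  "'a::real_vector set \<Rightarrow> ('a \<Rightarrow> 'b::real_vector) \<Rightarrow> bool" where
  "linear_on_subspace V f \<longleftrightarrow>
     (\<forall>x\<in>V. \<forall>y\<in>V. f (x + y) = f x + f y) \<and> (\<forall>c. \<forall>x\<in>V. f (c *\<^sub>R x) = c *\<^sub>R f x)"

definition hadamard_differentiable ::
  "('a::real_normed_vector \<Rightarrow> 'b::real_normed_vector) \<Rightarrow> 'a set \<Rightarrow> 'a \<Rightarrow> 'a set \<Rightarrow> bool" where
  "hadamard_differentiable \<phi> \<Theta> \<theta> D0 \<longleftrightarrow> \<theta> \<in> \<Theta> \<and> subspace D0 \<and>
     (\<exists>\<phi>'. linear_on_subspace D0 \<phi>' \<and> continuous_on D0 \<phi>' \<and>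
       (\<forall>h\<in>D0. \<forall>(t :: nat \<Rightarrow> real) hs.
          t \<longlonglongrightarrow> 0 \<and> (\<forall>n. t n \<noteq> 0) \<and> hs \<longlonglongrightarrow> h \<and> (\<forall>n. \<theta> + t n *\<^sub>R hs n \<in> \<Theta>) \<longrightarrow>
          (\<lambda>n. (1 / t n) *\<^sub>R (\<phi> (\<theta> + t n *\<^sub>R hs n) - \<phi> \<theta>)) \<longlonglongrightarrow> \<phi>' h))"

definition P0_ball ::
  "('s \<Rightarrow> real) set \<Rightarrow> 's measure set \<Rightarrow> 's measure \<Rightarrow> real \<Rightarrow> 's measure set" where
  "P0_ball \<F> P0 \<mu> \<epsilon> = {\<nu>\<in>P0. norm (emb \<F> \<nu> - emb \<F> \<mu>) < \<epsilon>}"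

text \<open>The map \<open>\<delta>\<close> transported along \<open>\<nu> \<mapsto> emb \<F> \<nu>\<close>. The choice of a preimage made by
  \<^const>\<open>inv_into\<close> is irrelevant when \<open>\<delta>\<close> is Lipschitz on the ball, see the lemma below.\<close>

definition delta_bar ::
  "('s \<Rightarrow> real) set \<Rightarrow> 's measure set \<Rightarrow> 's measure \<Rightarrow> real \<Rightarrow> ('s measure \<Rightarrow> 'e) \<Rightarrow>
   ('s \<Rightarrow> real) linf \<Rightarrow> 'e" where
  "delta_bar \<F> P0 \<mu> \<epsilon> \<delta> x = \<delta> (inv_into (P0_ball \<F> P0 \<mu> \<epsilon>) (emb \<F>) x)"

definition locally_lipschitz_at ::
  "('s \<Rightarrow> real) set \<Rightarrow> 's measure set \<Rightarrow> ('s measure \<Rightarrow> 'e::real_normed_vector) \<Rightarrow> 's measure \<Rightarrow>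
   real \<Rightarrow> real \<Rightarrow> bool" where
  "locally_lipschitz_at \<F> P0 \<delta> \<mu> \<epsilon> C \<longleftrightarrow>
     (\<forall>\<nu>\<in>P0. \<forall>\<nu>'\<in>P0. max (norm (emb \<F> \<nu> - emb \<F> \<mu>)) (norm (emb \<F> \<nu>' - emb \<F> \<mu>)) < \<epsilon> \<longrightarrow>
        norm (\<delta> \<nu> - \<delta> \<nu>') \<le> C * norm (emb \<F> \<nu> - emb \<F> \<nu>'))"

lemma delta_bar_emb:
  assumes "locally_lipschitz_at \<F> P0 \<delta> \<mu> \<epsilon> C" and \<nu>: "\<nu> \<in> P0_ball \<F> P0 \<mu> \<epsilon>"
  shows "delta_bar \<F> P0 \<mu> \<epsilon> \<delta> (emb \<F> \<nu>) = \<delta> \<nu>"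
proof -
  let ?B = "P0_ball \<F> P0 \<mu> \<epsilon>"
  let ?\<nu>' = "inv_into ?B (emb \<F>) (emb \<F> \<nu>)"
  have "?\<nu>' \<in> ?B" and eq: "emb \<F> ?\<nu>' = emb \<F> \<nu>"
    using \<nu> by (auto intro: inv_into_into f_inv_into_f)
  have "norm (\<delta> ?\<nu>' - \<delta> \<nu>) \<le> C * norm (emb \<F> ?\<nu>' - emb \<F> \<nu>)"
    using assms \<open>?\<nu>' \<in> ?B\<close> unfolding locally_lipschitz_at_def P0_ball_def
    by (metis (mono_tags, lifting) max_less_iff_conj mem_Collect_eq)
  then show ?thesis
    by (simp add: eq delta_bar_def)
qed

end

theory Submission
  imports Defs
begin

text \<open>
  The support of \<open>G\<close> is a subspace because centred Gaussian laws are invariant under rotations: if \<open>X\<close>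
  and \<open>Y\<close> are independent with the law of \<open>G\<close> and \<open>a\<^sup>2 + b\<^sup>2 = 1\<close>, then \<open>a X + b Y\<close> has that law again.
  On trigonometric polynomials this is a computation with characteristic functions; tightness and
  the Stone-Weierstrass theorem extend it to bounded continuous functions
  (\<open>integral_rotation_invariant\<close>). Hence the support is closed under \<open>(x, y) \<mapsto> a x + b y\<close>, and such
  rotations generate all scalar multiples and sums (\<open>subspace_top_support\<close>).

  The difference quotients of \<open>\<delta>\<close> are uniformly Lipschitz in the direction. Therefore the right
  derivative is Lipschitz on the rays spanned by \<open>P0\<close> at \<open>\<mu>\<close> and has exactly one continuous extension
  \<open>D\<close> to the tangent cone. The same bound allows perturbing the direction along with \<open>t\<close>, so the
  one-sided derivative along mixtures is a one-sided Hadamard derivative at each \<open>h\<close> in the cone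
  (\<open>one_sided_hadamard\<close>).

  The two parts meet in the inclusion of the support in the tangent cone
  (\<open>hj_limit_spt_subset_closed\<close>): all variables \<open>sqrt n (\<mu>n - \<mu>)\<close> take values in this closed set, so a
  limit in distribution charges no open set disjoint from it. Since the support is a subspace, it
  contains \<open>- h\<close> along with \<open>h\<close>, and linearity of \<open>D\<close> turns one-sided into two-sided
  differentiability.
\<close>

section \<open>Trigonometric polynomials\<close>

text \<open>The linear span of the functions $\cos L$ and $\sin L$. Integrals of its members against a law
  are determined by the one-dimensional laws of the functionals \<open>L\<close>.\<close>

inductive_set trig_polynomial :: "('a::real_normed_vector \<Rightarrow> real) set" where
  cos: "bounded_linear L \<Longrightarrow> (\<lambda>x. cos (L x)) \<in> trig_polynomial"
| sin: "bounded_linear L \<Longrightarrow> (\<lambda>x. sin (L x)) \<in> trig_polynomial"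
| scale: "f \<in> trig_polynomial \<Longrightarrow> (\<lambda>x. c * f x) \<in> trig_polynomial"
| add: "f \<in> trig_polynomial \<Longrightarrow> g \<in> trig_polynomial \<Longrightarrow> (\<lambda>x. f x + g x) \<in> trig_polynomial"

lemma trig_polynomial_const: "(\<lambda>x. c) \<in> trig_polynomial"
  using trig_polynomial.scale[OF trig_polynomial.cos[OF bounded_linear_zero], of c] by simp

lemma trig_polynomial_diff:
  "f \<in> trig_polynomial \<Longrightarrow> g \<in> trig_polynomial \<Longrightarrow> (\<lambda>x. f x - g x) \<in> trig_polynomial"
  using trig_polynomial.add[OF _ trig_polynomial.scale[of g "-1"], of f] by simp

text \<open>The addition formulas turn products into sums; this makes Stone-Weierstrass applicable.\<close>

lemma trig_polynomial_mult:
  assumes "f \<in> trig_polynomial" "g \<in> trig_polynomial"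
  shows "(\<lambda>x. f x * g x) \<in> trig_polynomial"
  using assms(1)
proof induction
  case L: (cos L)
  show ?case using assms(2)
  proof induction
    case (cos L')
    have "(\<lambda>x. (1/2) * (cos (L x - L' x) + cos (L x + L' x))) \<in> trig_polynomial"
      using L cos by (intro trig_polynomial.intros bounded_linear_add bounded_linear_sub)
    then show ?case by (simp add: cos_times_cos)
  next
    case (sin L')
    have "(\<lambda>x. (1/2) * (sin (L x + L' x) - sin (L x - L' x))) \<in> trig_polynomial"
      using L sin by (intro trig_polynomial.intros bounded_linear_add bounded_linear_sub trig_polynomial_diff)
    then show ?case by (simp add: cos_times_sin)
  next
    case (scale f c)
    then show ?case using trig_polynomial.scale[OF scale.IH, of c] by (simp add: mult_ac)
  next
    case (add f g)
    then show ?case using trig_polynomial.add[OF add.IH] by (simp add: algebra_simps)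
  qed
next
  case L: (sin L)
  show ?case using assms(2)
  proof induction
    case (cos L')
    have "(\<lambda>x. (1/2) * (sin (L x + L' x) + sin (L x - L' x))) \<in> trig_polynomial"
      using L cos by (intro trig_polynomial.intros bounded_linear_add bounded_linear_sub)
    then show ?case by (simp add: sin_times_cos)
  next
    case (sin L')
    have "(\<lambda>x. (1/2) * (cos (L x - L' x) - cos (L x + L' x))) \<in> trig_polynomial"
      using L sin by (intro trig_polynomial.intros bounded_linear_add bounded_linear_sub trig_polynomial_diff)
    then show ?case by (simp add: sin_times_sin)
  next
    case (scale f c)
    then show ?case using trig_polynomial.scale[OF scale.IH, of c] by (simp add: mult_ac)
  next
    case (add f g)
    then show ?case using trig_polynomial.add[OF add.IH] by (simp add: algebra_simps)
  qed
next
  case (scale f c)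
  then show ?case using trig_polynomial.scale[OF scale.IH, of c] by (simp add: mult_ac)
next
  case (add f g)
  then show ?case using trig_polynomial.add[OF add.IH] by (simp add: algebra_simps)
qed

lemma trig_polynomial_continuous:
  assumes "f \<in> trig_polynomial" shows "continuous_on UNIV f"
  using assms
  by induction (auto intro!: continuous_intros simp: linear_continuous_on)

lemma trig_polynomial_bounded:
  assumes "f \<in> trig_polynomial" shows "\<exists>B. \<forall>x. \<bar>f x\<bar> \<le> B"
  using assms
proof induction
  case (scale f c)
  then obtain B where "\<And>x. \<bar>f x\<bar> \<le> B" by auto
  then have "\<bar>c * f x\<bar> \<le> \<bar>c\<bar> * B" for x by (simp add: abs_mult mult_left_mono)
  then show ?case by auto
next
  case (add f g)
  then obtain A B where "\<And>x. \<bar>f x\<bar> \<le> A" "\<And>x. \<bar>g x\<bar> \<le> B" by auto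
  then have "\<bar>f x + g x\<bar> \<le> A + B" for x
    by (meson abs_triangle_ineq add_mono order_trans)
  then show ?case by auto
qed (auto intro: exI[of _ 1])

lemma trig_polynomial_compose_polynomial:
  fixes p :: "real \<Rightarrow> real"
  assumes "real_polynomial_function p" "g \<in> trig_polynomial"
  shows "(\<lambda>x. p (g x)) \<in> trig_polynomial"
  using assms(1)
proof induction
  case (linear h)
  have h: "h y = h 1 * y" for y
    using linear_scale[OF bounded_linear.linear[OF linear], of y 1] by (simp add: mult.commute)
  show ?case by (subst h) (rule trig_polynomial.scale[OF assms(2)])
qed (auto intro: trig_polynomial_const trig_polynomial.add trig_polynomial_mult)

text \<open>After scaling, both values of \<open>L\<close> lie in $[-1,1]$, where the sine is injective.\<close>

lemma trig_polynomial_separates: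
  fixes L :: "'a::real_normed_vector \<Rightarrow> real"
  assumes L: "bounded_linear L" and neq: "L x \<noteq> L y"
  shows "\<exists>f\<in>trig_polynomial. f x \<noteq> f y"
proof
  define c where "c = 1 / (\<bar>L x\<bar> + \<bar>L y\<bar>)"
  have pos: "\<bar>L x\<bar> + \<bar>L y\<bar> > 0" using neq by linarith
  then have "c > 0" by (simp add: c_def)
  have "\<bar>c * L x\<bar> \<le> 1" "\<bar>c * L y\<bar> \<le> 1"
    using pos by (simp_all add: c_def abs_mult divide_simps)
  moreover have "pi / 2 \<ge> 1" using pi_gt3 by simp
  ultimately have "c * L x = c * L y" if "sin (c * L x) = sin (c * L y)"
    using that by - (rule sin_inj_pi, linarith+)
  then show "sin (c * L x) \<noteq> sin (c * L y)" using neq \<open>c > 0\<close> by auto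
  show "(\<lambda>x. sin (c * L x)) \<in> trig_polynomial"
    by (intro trig_polynomial.sin bounded_linear_const_mult L)
qed

text \<open>Stone-Weierstrass alone controls the approximant only on \<open>K\<close>, while integrals also see
  its values elsewhere. A trigonometric polynomial \<open>g\<close> is bounded globally, so composing it with a
  polynomial that approximates the clipping to $[-1,1]$ on the range of \<open>g\<close> yields an approximant
  that is close to \<open>f\<close> on \<open>K\<close> and bounded by \<open>1 + e\<close> everywhere.\<close>

lemma trig_polynomial_approximation:
  fixes K :: "'a::real_normed_vector set"
  assumes sep: "\<And>x y :: 'a. x \<noteq> y \<Longrightarrow> \<exists>L::'a \<Rightarrow> real. bounded_linear L \<and> L x \<noteq> L y"
    and K: "compact K" and f: "continuous_on K f" "\<And>x. x \<in> K \<Longrightarrow> \<bar>f x\<bar> \<le> 1" and e: "e > 0"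
  shows "\<exists>h\<in>trig_polynomial. (\<forall>x\<in>K. \<bar>f x - h x\<bar> < e) \<and> (\<forall>x. \<bar>h x\<bar> \<le> 1 + e)"
proof -
  interpret function_ring_on trig_polynomial K
  proof
    show "continuous_on K f" if "f \<in> trig_polynomial" for f
      using trig_polynomial_continuous[OF that] continuous_on_subset by blast
    show "\<exists>f\<in>trig_polynomial. f x \<noteq> f y" if "x \<noteq> y" for x y :: 'a
      using sep[OF that] trig_polynomial_separates by blast
  qed (auto intro: K trig_polynomial.add trig_polynomial_mult trig_polynomial_const)
  obtain g where g: "g \<in> trig_polynomial" "\<And>x. x \<in> K \<Longrightarrow> \<bar>f x - g x\<bar> < e / 2"
    using Stone_Weierstrass_basic[OF f(1), of "e / 2"] e by auto
  obtain B where B: "\<And>x. \<bar>g x\<bar> \<le> B" using trig_polynomial_bounded[OF g(1)] by auto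
  define clip :: "real \<Rightarrow> real" where "clip y = max (-1) (min 1 y)" for y
  have "continuous_on {-B..B} clip"
    unfolding clip_def by (intro continuous_intros)
  then obtain p where p: "real_polynomial_function p" "\<And>y. y \<in> {-B..B} \<Longrightarrow> \<bar>clip y - p y\<bar> < e / 2"
    using Stone_Weierstrass_real_polynomial_function[of "{-B..B}" clip "e / 2"] e by auto
  have p': "\<bar>clip (g x) - p (g x)\<bar> < e / 2" for x
    using B[of x] by (intro p) (auto simp: abs_le_iff)
  show ?thesis
  proof (intro bexI conjI ballI allI)
    show "(\<lambda>x. p (g x)) \<in> trig_polynomial"
      by (rule trig_polynomial_compose_polynomial[OF p(1) g(1)])
    show "\<bar>p (g x)\<bar> \<le> 1 + e" for x
      using p'[of x] e by (auto simp: clip_def max_def min_def abs_if split: if_splits)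
    show "\<bar>f x - p (g x)\<bar> < e" if "x \<in> K" for x
      using p'[of x] g(2)[OF that] f(2)[OF that] unfolding clip_def by linarith
  qed
qed

section \<open>Tight centred Gaussian measures\<close>

text \<open>Gaussianity enters only through the characteristic functions of the one-dimensional laws,
  written in real form. Separation of points by functionals is what the Hahn-Banach theorem gives
  in general; on a space of bounded functions the evaluations provide it.\<close>

locale tight_centered_gaussian = prob_space Q for Q :: "'a::real_normed_vector measure" +
  assumes sets_Q [measurable_cong, simp]: "sets Q = sets borel"
    and tight: "\<And>e. e > 0 \<Longrightarrow> \<exists>K. compact K \<and> measure Q K \<ge> 1 - e"
    and char_gauss: "\<And>L. bounded_linear L \<Longrightarrow> \<exists>\<sigma>::real. \<forall>s::real.
          (\<integral>x. cos (s * L x) \<partial>Q) = exp (- (s * \<sigma>)\<^sup>2 / 2) \<and> (\<integral>x. sin (s * L x) \<partial>Q) = 0"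
    and separated: "\<And>x y :: 'a. x \<noteq> y \<Longrightarrow> \<exists>L::'a \<Rightarrow> real. bounded_linear L \<and> L x \<noteq> L y"
begin

lemma space_Q [simp]: "space Q = UNIV"
  using sets_eq_imp_space_eq[OF sets_Q] by simp

lemma prob_UNIV [simp]: "prob UNIV = 1"
  using prob_space by simp

lemma integrable_continuous_bounded:
  fixes f :: "'a \<Rightarrow> real"
  assumes "continuous_on UNIV f" "\<And>x. \<bar>f x\<bar> \<le> B"
  shows "integrable Q f"
proof (rule integrable_const_bound)
  show "AE x in Q. norm (f x) \<le> B" using assms by simp
  show "f \<in> borel_measurable Q"
    using borel_measurable_continuous_onI[OF assms(1)] by (simp cong: measurable_cong_sets)
qed

lemma abs_integral_le:
  fixes f :: "'a \<Rightarrow> real"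
  assumes "\<And>x. \<bar>f x\<bar> \<le> B"
  shows "\<bar>\<integral>x. f x \<partial>Q\<bar> \<le> B"
proof -
  have B: "0 \<le> B" using assms order_trans[OF abs_ge_zero] by blast
  show ?thesis
  proof (cases "integrable Q f")
    case True
    have "\<bar>\<integral>x. f x \<partial>Q\<bar> \<le> (\<integral>x. \<bar>f x\<bar> \<partial>Q)" by (rule integral_abs_bound)
    also have "\<dots> \<le> (\<integral>x. B \<partial>Q)" using True assms by (intro integral_mono) auto
    finally show ?thesis by simp
  qed (simp add: not_integrable_integral_eq B)
qed

text \<open>The integral of \<open>f\<close> against the law of \<open>a X + b Y\<close> for independent \<open>X\<close> and \<open>Y\<close> with law \<open>Q\<close>.
  It is written as an iterated integral because on a non-separable space addition need not be
  measurable for the product of the Borel \<open>\<sigma>\<close>-algebras. For continuous \<open>f\<close> the inner integral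
  depends continuously on \<open>v\<close>, so no product measure is needed.\<close>

definition rotated_integral :: "real \<Rightarrow> real \<Rightarrow> ('a \<Rightarrow> real) \<Rightarrow> real" where
  "rotated_integral a b f = (\<integral>v. (\<integral>u. f (a *\<^sub>R u + b *\<^sub>R v) \<partial>Q) \<partial>Q)"

lemma continuous_on_slice:
  fixes f :: "'a \<Rightarrow> real"
  assumes "continuous_on UNIV f"
  shows "continuous_on UNIV (\<lambda>u. f (a *\<^sub>R u + b *\<^sub>R v))"
  by (rule continuous_on_compose2[OF assms]) (auto intro!: continuous_intros)

lemma integrable_slice:
  fixes f :: "'a \<Rightarrow> real"
  assumes "continuous_on UNIV f" "\<And>x. \<bar>f x\<bar> \<le> B"
  shows "integrable Q (\<lambda>u. f (a *\<^sub>R u + b *\<^sub>R v))"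
  by (rule integrable_continuous_bounded[OF continuous_on_slice[OF assms(1)] assms(2)])

lemma continuous_on_integral_slice:
  fixes f :: "'a \<Rightarrow> real"
  assumes f: "continuous_on UNIV f" "\<And>x. \<bar>f x\<bar> \<le> B"
  shows "continuous_on UNIV (\<lambda>v. \<integral>u. f (a *\<^sub>R u + b *\<^sub>R v) \<partial>Q)"
  unfolding continuous_on_sequentially comp_def
proof safe
  fix x :: "nat \<Rightarrow> 'a" and v assume x: "x \<longlonglongrightarrow> v"
  show "(\<lambda>n. \<integral>u. f (a *\<^sub>R u + b *\<^sub>R x n) \<partial>Q) \<longlonglongrightarrow> (\<integral>u. f (a *\<^sub>R u + b *\<^sub>R v) \<partial>Q)"
  proof (rule integral_dominated_convergence[where w = "\<lambda>_. B"])
    show "AE u in Q. (\<lambda>n. f (a *\<^sub>R u + b *\<^sub>R x n)) \<longlonglongrightarrow> f (a *\<^sub>R u + b *\<^sub>R v)"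
    proof (rule AE_I2)
      fix u
      have "(\<lambda>n. a *\<^sub>R u + b *\<^sub>R x n) \<longlonglongrightarrow> a *\<^sub>R u + b *\<^sub>R v"
        by (intro tendsto_intros x)
      then show "(\<lambda>n. f (a *\<^sub>R u + b *\<^sub>R x n)) \<longlonglongrightarrow> f (a *\<^sub>R u + b *\<^sub>R v)"
        using continuous_on_tendsto_compose[OF f(1)] by simp
    qed
  qed (use f in \<open>auto intro!: borel_measurable_integrable[OF integrable_slice[OF f]]\<close>)
qed

lemma integrable_integral_slice:
  fixes f :: "'a \<Rightarrow> real"
  assumes "continuous_on UNIV f" "\<And>x. \<bar>f x\<bar> \<le> B"
  shows "integrable Q (\<lambda>v. \<integral>u. f (a *\<^sub>R u + b *\<^sub>R v) \<partial>Q)"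
  using assms by (intro integrable_continuous_bounded[OF continuous_on_integral_slice] abs_integral_le)

lemma rotated_integral_add:
  fixes f g :: "'a \<Rightarrow> real"
  assumes f: "continuous_on UNIV f" "\<And>x. \<bar>f x\<bar> \<le> A" and g: "continuous_on UNIV g" "\<And>x. \<bar>g x\<bar> \<le> B"
  shows "rotated_integral a b (\<lambda>x. f x + g x) = rotated_integral a b f + rotated_integral a b g"
  unfolding rotated_integral_def
  by (simp add: integrable_slice[OF f] integrable_slice[OF g]
      integrable_integral_slice[OF f] integrable_integral_slice[OF g])

lemma rotated_integral_cmult: "rotated_integral a b (\<lambda>x. c * f x) = c * rotated_integral a b f"
  unfolding rotated_integral_def by simp

text \<open>The two factors produced by the addition formulas have characteristic exponents that add up
  to \<open>(a\<^sup>2 + b\<^sup>2) \<sigma>\<^sup>2\<close>.\<close>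

lemma rotated_integral_trig_polynomial:
  assumes h: "h \<in> trig_polynomial" and ab: "a\<^sup>2 + b\<^sup>2 = 1"
  shows "rotated_integral a b h = (\<integral>x. h x \<partial>Q)"
  using h
proof induction
  case (scale f c)
  then show ?case by (simp add: rotated_integral_cmult)
next
  case (add f g)
  obtain A B where AB: "\<And>x. \<bar>f x\<bar> \<le> A" "\<And>x. \<bar>g x\<bar> \<le> B"
    using add.hyps trig_polynomial_bounded by metis
  note c = trig_polynomial_continuous[OF add.hyps(1)] trig_polynomial_continuous[OF add.hyps(2)]
  show ?case
    using integrable_continuous_bounded[OF c(1) AB(1)] integrable_continuous_bounded[OF c(2) AB(2)]
    by (simp add: rotated_integral_add[OF c(1) AB(1) c(2) AB(2)] add.IH)
next
  case (cos L)
  then interpret L: bounded_linear L .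
  obtain \<sigma> where \<sigma>: "\<And>s. (\<integral>x. cos (s * L x) \<partial>Q) = exp (- (s * \<sigma>)\<^sup>2 / 2)"
      "\<And>s. (\<integral>x. sin (s * L x) \<partial>Q) = 0"
    using char_gauss[OF cos] by metis
  have [simp]: "integrable Q (\<lambda>u. cos (s * L u))" "integrable Q (\<lambda>u. sin (s * L u))" for s
    by (rule integrable_continuous_bounded[where B = 1]; auto intro!: continuous_intros L.continuous_on)+
  have "rotated_integral a b (\<lambda>x. cos (L x)) = exp (- (a * \<sigma>)\<^sup>2 / 2) * exp (- (b * \<sigma>)\<^sup>2 / 2)"
    by (simp add: rotated_integral_def L.add L.scaleR cos_add \<sigma>)
  also have "\<dots> = exp (- ((a\<^sup>2 + b\<^sup>2) * \<sigma>\<^sup>2) / 2)"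
    by (simp add: exp_add[symmetric] field_simps power_mult_distrib)
  also have "\<dots> = (\<integral>x. cos (L x) \<partial>Q)" using \<sigma>(1)[of 1] by (simp add: ab)
  finally show ?case .
next
  case (sin L)
  then interpret L: bounded_linear L .
  obtain \<sigma> where \<sigma>: "\<And>s. (\<integral>x. sin (s * L x) \<partial>Q) = 0"
    using char_gauss[OF sin] by metis
  have [simp]: "integrable Q (\<lambda>u. cos (s * L u))" "integrable Q (\<lambda>u. sin (s * L u))" for s
    by (rule integrable_continuous_bounded[where B = 1]; auto intro!: continuous_intros L.continuous_on)+
  show ?case using \<sigma>[of 1]
    by (simp add: rotated_integral_def L.add L.scaleR sin_add \<sigma>)
qed

lemma integral_le_off_compact:
  fixes d :: "'a \<Rightarrow> real"
  assumes K: "compact K" "measure Q K \<ge> 1 - e"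
    and d: "continuous_on UNIV d" "\<And>x. \<bar>d x\<bar> \<le> B" "\<And>x. x \<in> K \<Longrightarrow> \<bar>d x\<bar> \<le> c"
    and pos: "c \<ge> 0" "B \<ge> 0"
  shows "\<bar>\<integral>x. d x \<partial>Q\<bar> \<le> c + B * e"
proof -
  have Kb: "K \<in> sets borel" using K(1) by (simp add: compact_imp_closed borel_closed)
  have "\<bar>\<integral>x. d x \<partial>Q\<bar> \<le> (\<integral>x. \<bar>d x\<bar> \<partial>Q)" by (rule integral_abs_bound)
  also have "\<dots> \<le> (\<integral>x. c + B * indicator (- K) x \<partial>Q)"
  proof (rule integral_mono)
    show "integrable Q (\<lambda>x. \<bar>d x\<bar>)"
      by (intro integrable_abs integrable_continuous_bounded[OF d(1,2)])
    show "integrable Q (\<lambda>x. c + B * indicat_real (- K) x)"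
      using Kb by (simp add: emeasure_eq_measure)
    show "\<bar>d x\<bar> \<le> c + B * indicator (- K) x" for x
      using d(2)[of x] d(3)[of x] pos by (auto simp: indicator_def)
  qed
  also have "\<dots> = c + B * measure Q (- K)"
    using Kb by (simp add: emeasure_eq_measure)
  also have "\<dots> \<le> c + B * e"
    using K(2) prob_compl[of K] Kb pos by (simp add: Compl_eq_Diff_UNIV mult_left_mono)
  finally show ?thesis .
qed

text \<open>Both sides agree on trigonometric polynomials and, by tightness, both are nearly concentrated
  on one compact set: \<open>K\<close> together with all \<open>a u + b v\<close> for \<open>u\<close> and \<open>v\<close> in \<open>K\<close>. Approximating \<open>f\<close> there
  by a globally bounded trigonometric polynomial carries the identity over to \<open>f\<close>.\<close>

lemma integral_rotation_invariant:
  fixes f :: "'a \<Rightarrow> real"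
  assumes ab: "a\<^sup>2 + b\<^sup>2 = 1" and f: "continuous_on UNIV f" "\<And>x. \<bar>f x\<bar> \<le> 1"
  shows "rotated_integral a b f = (\<integral>x. f x \<partial>Q)"
proof -
  have est: "\<bar>rotated_integral a b f - (\<integral>x. f x \<partial>Q)\<bar> \<le> 11 * e" if e: "0 < e" "e \<le> 1" for e
  proof -
    obtain K where K: "compact K" "measure Q K \<ge> 1 - e" using tight[OF e(1)] by auto
    define K' where "K' = K \<union> {x + y |x y. x \<in> (*\<^sub>R) a ` K \<and> y \<in> (*\<^sub>R) b ` K}"
    have K': "compact K'"
      unfolding K'_def by (intro compact_Un K compact_sums compact_scaling)
    obtain h where h: "h \<in> trig_polynomial" "\<And>x. x \<in> K' \<Longrightarrow> \<bar>f x - h x\<bar> < e" "\<And>x. \<bar>h x\<bar> \<le> 1 + e"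
      using trig_polynomial_approximation[OF separated K' continuous_on_subset[OF f(1)], of e] f(2) e(1)
      by auto
    define d where "d x = f x - h x" for x
    have d: "continuous_on UNIV d"
      unfolding d_def by (intro continuous_intros f trig_polynomial_continuous[OF h(1)])
    have d3: "\<bar>d x\<bar> \<le> 3" for x
      using f(2)[of x] h(3)[of x] e unfolding d_def by linarith
    have dK: "\<bar>d x\<bar> \<le> e" if "x \<in> K'" for x using h(2)[OF that] by (simp add: d_def)
    \<comment> \<open>The remainder \<open>d\<close> contributes at most \<open>4 e\<close> to the plain integral; in the iterated integral, the mass
      outside \<open>K\<close> is paid for twice, which gives at most \<open>7 e\<close>.\<close>
    have dec: "f = (\<lambda>x. h x + d x)" by (simp add: d_def)
    have h2: "\<bar>h x\<bar> \<le> 2" for x using h(3)[of x] e by linarith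
    note hc = trig_polynomial_continuous[OF h(1)]
    have "rotated_integral a b f = rotated_integral a b h + rotated_integral a b d"
      by (subst dec) (rule rotated_integral_add[OF hc h2 d d3])
    moreover have "(\<integral>x. f x \<partial>Q) = (\<integral>x. h x \<partial>Q) + (\<integral>x. d x \<partial>Q)"
      by (subst dec) (intro Bochner_Integration.integral_add
          integrable_continuous_bounded[OF hc h2] integrable_continuous_bounded[OF d d3])
    moreover have "\<bar>\<integral>x. d x \<partial>Q\<bar> \<le> e + 3 * e"
      by (rule integral_le_off_compact[OF K d d3]) (use e dK in \<open>auto simp: K'_def\<close>)
    moreover have "\<bar>rotated_integral a b d\<bar> \<le> (e + 3 * e) + 3 * e"
      unfolding rotated_integral_def
    proof (rule integral_le_off_compact[OF K continuous_on_integral_slice[OF d d3] abs_integral_le[OF d3]])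
      fix v assume v: "v \<in> K"
      show "\<bar>\<integral>u. d (a *\<^sub>R u + b *\<^sub>R v) \<partial>Q\<bar> \<le> e + 3 * e"
        by (rule integral_le_off_compact[OF K continuous_on_slice[OF d] d3])
          (use e v in \<open>auto intro!: dK simp: K'_def, blast\<close>)
    qed (use e in auto)
    ultimately show ?thesis
      using rotated_integral_trig_polynomial[OF h(1) ab] by linarith
  qed
  have "\<bar>rotated_integral a b f - (\<integral>x. f x \<partial>Q)\<bar> \<le> 0"
  proof (rule field_le_epsilon)
    fix r :: real assume "r > 0"
    then show "\<bar>rotated_integral a b f - (\<integral>x. f x \<partial>Q)\<bar> \<le> 0 + r"
      using est[of "min 1 (r / 11)"] by (cases "r \<ge> 11") (auto simp: min_def)
  qed
  then show ?thesis by simp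
qed

end

section \<open>The topological support\<close>

lemma top_support_iff_ball:
  fixes Q :: "'a::metric_space measure"
  assumes "sets Q = sets borel"
  shows "x \<in> top_support Q \<longleftrightarrow> (\<forall>r>0. emeasure Q (ball x r) > 0)"
proof
  assume *: "\<forall>r>0. emeasure Q (ball x r) > 0"
  show "x \<in> top_support Q"
    unfolding top_support_def
  proof safe
    fix U :: "'a set" assume "open U" "x \<in> U"
    then obtain r where r: "r > 0" "ball x r \<subseteq> U" using open_contains_ball by metis
    have "emeasure Q (ball x r) \<le> emeasure Q U"
      using r \<open>open U\<close> assms by (intro emeasure_mono) auto
    then show "emeasure Q U > 0" using * r less_le_trans by blast
  qed
qed (auto simp: top_support_def)

text \<open>Otherwise finitely many open null sets would cover \<open>K\<close>. Tightness supplies such a set \<open>K\<close>, so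
  the support of a tight law has a point to start from.\<close>

lemma top_support_if_compact_positive:
  assumes Q: "sets Q = sets borel" and K: "compact K" "emeasure Q K > 0"
  shows "top_support Q \<noteq> {}"
proof
  assume "top_support Q = {}"
  then have "\<forall>x. \<exists>U. open U \<and> x \<in> U \<and> emeasure Q U = 0"
    by (fastforce simp: top_support_def)
  then obtain U where U: "\<And>x. open (U x)" "\<And>x. x \<in> U x" "\<And>x. emeasure Q (U x) = 0"
    by metis
  obtain C where C: "C \<subseteq> K" "finite C" "K \<subseteq> (\<Union>x\<in>C. U x)"
  proof (rule compactE_image[OF K(1), of K U])
    show "K \<subseteq> (\<Union>x\<in>K. U x)" using U(2) by blast
  qed (use U(1) in auto)
  have "(\<Union>x\<in>C. U x) \<in> null_sets Q"
    using C U Q by (intro null_sets_UN' countable_finite) (auto simp: null_sets_def)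
  then have "emeasure Q (\<Union>x\<in>C. U x) = 0" by blast
  moreover have "emeasure Q K \<le> emeasure Q (\<Union>x\<in>C. U x)"
    using C U Q by (intro emeasure_mono) auto
  ultimately show False using K(2) by simp
qed

text \<open>A continuous minorant of the indicator of \<open>ball z r\<close> that is at least one half on the ball of
  half the radius.\<close>

definition bump :: "'a::metric_space \<Rightarrow> real \<Rightarrow> 'a \<Rightarrow> real" where
  "bump z r x = max 0 (1 - dist z x / r)"

lemma continuous_on_bump [continuous_intros]: "continuous_on A (bump z r)"
  unfolding bump_def divide_inverse by (intro continuous_intros)

lemma bump_nonneg: "0 \<le> bump z r x" by (simp add: bump_def)

lemma bump_le_1: "r > 0 \<Longrightarrow> bump z r x \<le> 1" by (simp add: bump_def)

lemma bump_eq_0: "r > 0 \<Longrightarrow> x \<notin> ball z r \<Longrightarrow> bump z r x = 0"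
  by (simp add: bump_def field_simps)

lemma bump_ge_half: "r > 0 \<Longrightarrow> x \<in> ball z (r / 2) \<Longrightarrow> 1/2 \<le> bump z r x"
  by (simp add: bump_def field_simps)

context tight_centered_gaussian
begin

text \<open>For a bump \<open>f\<close> around \<open>a x + b y\<close>, the iterated integral of \<open>f (a u + b v)\<close> is positive, since \<open>u\<close>
  near \<open>x\<close> and \<open>v\<close> near \<open>y\<close> have positive mass. By rotation invariance so is the integral of \<open>f\<close>.\<close>

lemma top_support_rotation:
  assumes ab: "a\<^sup>2 + b\<^sup>2 = 1" and x: "x \<in> top_support Q" and y: "y \<in> top_support Q"
  shows "a *\<^sub>R x + b *\<^sub>R y \<in> top_support Q"
  unfolding top_support_iff_ball[OF sets_Q]
proof safe
  fix r :: real assume r: "r > 0"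
  let ?z = "a *\<^sub>R x + b *\<^sub>R y"
  let ?f = "bump ?z r"
  define s where "s = r / 4"
  have s: "s > 0" using r by (simp add: s_def)
  have "a\<^sup>2 \<le> 1" "b\<^sup>2 \<le> 1" using ab zero_le_power2[of a] zero_le_power2[of b] by linarith+
  then have ab1: "\<bar>a\<bar> \<le> 1" "\<bar>b\<bar> \<le> 1" by (simp_all only: abs_square_le_1)
  have f1: "\<bar>?f u\<bar> \<le> 1" for u using bump_nonneg[of ?z r u] bump_le_1[OF r] by (simp)
  have f: "continuous_on UNIV ?f" by (intro continuous_intros)
  have near: "1/2 \<le> ?f (a *\<^sub>R u + b *\<^sub>R v)" if "u \<in> ball x s" "v \<in> ball y s" for u v
  proof (rule bump_ge_half[OF r])
    have "dist ?z (a *\<^sub>R u + b *\<^sub>R v) = norm (a *\<^sub>R (x - u) + b *\<^sub>R (y - v))"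
      by (simp add: dist_norm algebra_simps)
    also have "\<dots> \<le> \<bar>a\<bar> * norm (x - u) + \<bar>b\<bar> * norm (y - v)"
      by (metis norm_scaleR norm_triangle_ineq)
    also have "\<dots> \<le> norm (x - u) + norm (y - v)"
      using ab1 by (intro add_mono mult_left_le_one_le) auto
    also have "\<dots> < s + s" using that by (intro add_strict_mono) (auto simp: dist_norm)
    finally show "a *\<^sub>R u + b *\<^sub>R v \<in> ball ?z (r / 2)" by (simp add: s_def)
  qed
  have pos: "measure Q (ball x s) > 0" "measure Q (ball y s) > 0"
    using x y s top_support_iff_ball[OF sets_Q] by (auto simp: emeasure_eq_measure)
  have inner: "(\<integral>u. ?f (a *\<^sub>R u + b *\<^sub>R v) \<partial>Q) \<ge> (1/2 * measure Q (ball x s)) * indicator (ball y s) v" for v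
  proof (cases "v \<in> ball y s")
    case True
    have "(\<integral>u. 1/2 * indicator (ball x s) u \<partial>Q) \<le> (\<integral>u. ?f (a *\<^sub>R u + b *\<^sub>R v) \<partial>Q)"
    proof (rule integral_mono[OF _ integrable_slice[OF f f1]])
      show "1/2 * indicator (ball x s) u \<le> ?f (a *\<^sub>R u + b *\<^sub>R v)" for u
        using near[OF _ True] bump_nonneg by (auto simp: indicator_def)
    qed (simp add: emeasure_eq_measure)
    then show ?thesis using True by simp
  next
    case False
    then show ?thesis by (simp add: bump_nonneg)
  qed
  have "0 < (1/2 * measure Q (ball x s)) * measure Q (ball y s)" using pos by simp
  also have "\<dots> = (\<integral>v. (1/2 * measure Q (ball x s)) * indicator (ball y s) v \<partial>Q)" by simp
  also have "\<dots> \<le> rotated_integral a b ?f"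
    unfolding rotated_integral_def
    by (rule integral_mono[OF _ integrable_integral_slice[OF f f1] inner]) (simp add: emeasure_eq_measure)
  also have "\<dots> = (\<integral>w. ?f w \<partial>Q)" by (rule integral_rotation_invariant[OF ab f f1])
  also have "\<dots> \<le> (\<integral>w. indicator (ball ?z r) w \<partial>Q)"
  proof (rule integral_mono[OF integrable_continuous_bounded[OF f f1]])
    show "?f w \<le> indicator (ball ?z r) w" for w
      using bump_le_1[OF r] bump_eq_0[OF r, of w ?z] by (auto simp: indicator_def)
  qed (simp add: emeasure_eq_measure)
  also have "\<dots> = measure Q (ball ?z r)" by simp
  finally show "emeasure Q (ball ?z r) > 0" by (simp add: emeasure_eq_measure)
qed

text \<open>Rotating the pair \<open>(x, x)\<close> gives \<open>(a + b) x\<close> with \<open>a\<^sup>2 + b\<^sup>2 = 1\<close>. The sum \<open>a + b\<close> takes every value \<open>c\<close>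
  with \<open>c\<^sup>2 \<le> 2\<close>; iterating the factor \<open>sqrt 2\<close> reaches the other scalars.\<close>

lemma top_support_scale:
  assumes x: "x \<in> top_support Q"
  shows "c *\<^sub>R x \<in> top_support Q"
proof -
  have small: "c *\<^sub>R x \<in> top_support Q" if c: "c\<^sup>2 \<le> 2" and x: "x \<in> top_support Q" for c x
  proof -
    \<comment> \<open>The solutions of \<open>a + b = c\<close> and \<open>a\<^sup>2 + b\<^sup>2 = 1\<close> are \<open>(c + q) / 2\<close> and \<open>(c - q) / 2\<close>.\<close>
    define q where "q = sqrt (2 - c\<^sup>2)"
    have q: "q\<^sup>2 = 2 - c\<^sup>2" using c by (simp add: q_def)
    have "((c + q) / 2)\<^sup>2 + ((c - q) / 2)\<^sup>2 = 1"
      using q by (simp add: power2_eq_square field_simps)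
    from top_support_rotation[OF this x x] show ?thesis
      by (simp add: scaleR_add_left[symmetric] field_simps)
  qed
  have sqrt2: "(sqrt 2)^k *\<^sub>R x \<in> top_support Q" for k
  proof (induction k)
    case (Suc k)
    then show ?case using small[of "sqrt 2" "sqrt 2 ^ k *\<^sub>R x"] by simp
  qed (simp add: x)
  obtain k where k: "\<bar>c\<bar> < (sqrt 2)^k" using real_arch_pow[of "sqrt 2" "\<bar>c\<bar>"] by auto
  let ?p = "(sqrt 2)^k :: real"
  have p: "?p > 0" by simp
  have "\<bar>c / ?p\<bar> \<le> 1" using k p by (simp add: abs_divide)
  then have "(c / ?p)\<^sup>2 \<le> 1" by (simp only: abs_square_le_1)
  then have "(c / ?p)\<^sup>2 \<le> 2" by linarith
  from small[OF this sqrt2[of k]] show ?thesis using p by simp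
qed

theorem subspace_top_support: "subspace (top_support Q)"
proof (rule subspaceI)
  obtain K where K: "compact K" "measure Q K \<ge> 1 - 1/2" using tight[of "1/2"] by auto
  then have "top_support Q \<noteq> {}"
    by (intro top_support_if_compact_positive[OF sets_Q, of K]) (auto simp: emeasure_eq_measure)
  then show "0 \<in> top_support Q" using top_support_scale[of _ 0] by force
  show "x + y \<in> top_support Q" if "x \<in> top_support Q" "y \<in> top_support Q" for x y
  proof -
    have "(1 / sqrt 2)\<^sup>2 + (1 / sqrt 2)\<^sup>2 = 1" by (simp add: power_divide)
    from top_support_scale[OF top_support_rotation[OF this that], of "sqrt 2"]
    show ?thesis by (simp add: scaleR_add_right)
  qed
qed (rule top_support_scale)

end

section \<open>Gaussian random elements\<close>

lemma std_normal_trig_integrals: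
  "(\<integral>x. cos (t * x) \<partial>std_normal_distribution) = exp (- t\<^sup>2 / 2)"
  "(\<integral>x. sin (t * x) \<partial>std_normal_distribution) = 0"
proof -
  interpret real_distribution std_normal_distribution by (rule real_dist_normal_dist)
  have int: "integrable std_normal_distribution (\<lambda>x. iexp (t * x))"
    by (rule integrable_iexp) auto
  have char: "(CLINT x|std_normal_distribution. iexp (t * x)) = complex_of_real (exp (- t\<^sup>2 / 2))"
    using char_std_normal_distribution by (simp add: char_def fun_eq_iff)
  have "(\<integral>x. Re (iexp (t * x)) \<partial>std_normal_distribution) = exp (- t\<^sup>2 / 2)"
    unfolding integral_Re[OF int] char by (rule Re_complex_of_real)
  then show "(\<integral>x. cos (t * x) \<partial>std_normal_distribution) = exp (- t\<^sup>2 / 2)"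
    by (simp add: Re_exp)
  have "(\<integral>x. Im (iexp (t * x)) \<partial>std_normal_distribution) = 0"
    unfolding integral_Im[OF int] char by (rule Im_complex_of_real)
  then show "(\<integral>x. sin (t * x) \<partial>std_normal_distribution) = 0"
    by (simp add: Im_exp)
qed

lemma integral_normal_density_scale:
  fixes f :: "real \<Rightarrow> real"
  assumes \<sigma>: "\<sigma> > 0" and [measurable]: "f \<in> borel_measurable borel"
  shows "(\<integral>x. f x \<partial>density lborel (normal_density 0 \<sigma>)) = (\<integral>x. f (\<sigma> * x) \<partial>std_normal_distribution)"
proof -
  have dens: "\<sigma> * normal_density 0 \<sigma> (\<sigma> * x) = std_normal_density x" for x
    using \<sigma> by (simp add: normal_density_def real_sqrt_mult power_mult_distrib field_simps)
  have "(\<integral>x. f x \<partial>density lborel (normal_density 0 \<sigma>)) = (\<integral>x. normal_density 0 \<sigma> x * f x \<partial>lborel)"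
    by (subst integral_density) (auto simp: normal_density_nonneg)
  also have "\<dots> = \<sigma> * (\<integral>x. normal_density 0 \<sigma> (\<sigma> * x) * f (\<sigma> * x) \<partial>lborel)"
    using lborel_integral_real_affine[of \<sigma> "\<lambda>x. normal_density 0 \<sigma> x * f x" 0] \<sigma> by simp
  also have "\<dots> = (\<integral>x. std_normal_density x * f (\<sigma> * x) \<partial>lborel)"
    by (simp add: dens[symmetric] mult.assoc)
  also have "\<dots> = (\<integral>x. f (\<sigma> * x) \<partial>std_normal_distribution)"
    by (subst integral_density) (auto simp: normal_density_nonneg)
  finally show ?thesis .
qed

text \<open>Every law allowed for \<open>L G\<close>, the point mass at \<open>0\<close> included, is the image of the standard normal
  law under multiplication by some \<open>\<sigma>\<close>.\<close>

lemma centered_gaussian_trig_integrals: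
  assumes gauss: "centered_gaussian N G" and L: "bounded_linear L"
  shows "\<exists>\<sigma>::real. \<forall>s::real.
    (\<integral>x. cos (s * L x) \<partial>distr N borel G) = exp (- (s * \<sigma>)\<^sup>2 / 2) \<and>
    (\<integral>x. sin (s * L x) \<partial>distr N borel G) = 0"
proof -
  have [measurable]: "G \<in> borel_measurable N" using gauss by (simp add: centered_gaussian_def)
  have [measurable]: "L \<in> borel_measurable borel"
    using L by (intro borel_measurable_continuous_onI linear_continuous_on)
  obtain \<sigma> where \<sigma>: "\<sigma> \<ge> 0" and law: "distr N borel (\<lambda>v. L (G v)) =
      (if \<sigma> = 0 then return borel 0 else density lborel (\<lambda>x. ennreal (normal_density 0 \<sigma> x)))"
    using gauss L unfolding centered_gaussian_def by metis
  have push: "(\<integral>x. f (L x) \<partial>distr N borel G) = (\<integral>x. f (\<sigma> * x) \<partial>std_normal_distribution)"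
    if [measurable]: "f \<in> borel_measurable borel" for f :: "real \<Rightarrow> real"
  proof -
    have "(\<integral>x. f (L x) \<partial>distr N borel G) = (\<integral>y. f y \<partial>distr N borel (\<lambda>v. L (G v)))"
      by (simp add: integral_distr)
    also have "\<dots> = (\<integral>x. f (\<sigma> * x) \<partial>std_normal_distribution)"
    proof (cases "\<sigma> = 0")
      case True
      interpret real_distribution std_normal_distribution by (rule real_dist_normal_dist)
      show ?thesis using True prob_space by (simp add: law integral_return)
    next
      case False
      then have "distr N borel (\<lambda>v. L (G v)) = density lborel (normal_density 0 \<sigma>)"
        using law by simp
      then show ?thesis using False \<sigma> by (simp only: integral_normal_density_scale[OF _ that])
    qed
    finally show ?thesis .
  qed
  have trig: "(\<lambda>x. cos (s * x)) \<in> borel_measurable borel" "(\<lambda>x. sin (s * x)) \<in> borel_measurable borel" for s :: real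
    by measurable
  have "(\<integral>x. cos (s * L x) \<partial>distr N borel G) = exp (- (s * \<sigma>)\<^sup>2 / 2)" for s
    using push[OF trig(1), of s] std_normal_trig_integrals(1)[of "s * \<sigma>"] by (simp only: mult.assoc)
  moreover have "(\<integral>x. sin (s * L x) \<partial>distr N borel G) = 0" for s
    using push[OF trig(2), of s] std_normal_trig_integrals(2)[of "s * \<sigma>"] by (simp only: mult.assoc)
  ultimately show ?thesis by blast
qed

lemma bounded_linear_apply_bcontfun:
  "bounded_linear (\<lambda>f :: 'a::topological_space \<Rightarrow>\<^sub>C 'b::real_normed_vector. apply_bcontfun f x)"
  by (rule bounded_linear_intro[where K = 1]) (auto intro: norm_bounded)

theorem subspace_spt_gaussian:
  fixes G :: "'v \<Rightarrow> ('a::topological_space \<Rightarrow>\<^sub>C real)"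
  assumes "prob_space N" and gauss: "centered_gaussian N G" and tight: "tight_rv N G"
  shows "subspace (spt N G)"
proof -
  have [measurable]: "G \<in> borel_measurable N" using gauss by (simp add: centered_gaussian_def)
  interpret N: prob_space N by fact
  interpret Q: prob_space "distr N borel G" by (rule N.prob_space_distr) simp
  interpret tight_centered_gaussian "distr N borel G"
  proof
    show "\<exists>L :: _ \<Rightarrow> real. bounded_linear L \<and> L x \<noteq> L y" if neq: "x \<noteq> y" for x y :: "'a \<Rightarrow>\<^sub>C real"
    proof -
      obtain p where "apply_bcontfun x p \<noteq> apply_bcontfun y p" using neq bcontfun_eqI[of x y] by blast
      then show ?thesis
        by (intro exI[of _ "\<lambda>f. apply_bcontfun f p"] conjI bounded_linear_apply_bcontfun)
    qed
    show "\<exists>K. compact K \<and> measure (distr N borel G) K \<ge> 1 - e" if "e > 0" for e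
      using tight that unfolding tight_rv_def by blast
  qed (rule sets_distr, rule centered_gaussian_trig_integrals[OF gauss])
  show ?thesis unfolding spt_def by (rule subspace_top_support)
qed

lemma spt_subset_closed:
  assumes "G \<in> borel_measurable N" "closed T" "\<And>v. v \<in> space N \<Longrightarrow> G v \<in> T"
  shows "spt N G \<subseteq> T"
proof
  fix x assume x: "x \<in> spt N G"
  show "x \<in> T"
  proof (rule ccontr)
    assume "x \<notin> T"
    then have "emeasure (distr N borel G) (- T) > 0"
      using x assms(2) by (simp add: spt_def top_support_def open_Compl)
    moreover have "G -` (- T) \<inter> space N = {}" using assms(3) by auto
    ultimately show False using assms(1,2) by (simp add: emeasure_distr)
  qed
qed

lemma outer_expectation_zero:
  assumes "prob_space M" "\<And>w. w \<in> space M \<Longrightarrow> Z w = 0"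
  shows "outer_expectation M Z = 0"
  unfolding outer_expectation_def
proof (rule cInf_eq_minimum)
  show "0 \<in> {integral\<^sup>L M U |U. integrable M U \<and> (\<forall>w\<in>space M. Z w \<le> U w)}"
    using assms(2) by (intro CollectI exI[of _ "\<lambda>_. 0"]) auto
  show "0 \<le> y" if "y \<in> {integral\<^sup>L M U |U. integrable M U \<and> (\<forall>w\<in>space M. Z w \<le> U w)}" for y
    using that assms(2) by (auto intro!: Bochner_Integration.integral_nonneg)
qed

text \<open>The part of the portmanteau theorem needed here: at a point of the support outside \<open>T\<close>, test
  the convergence with a bump that vanishes on \<open>T\<close>. Its outer expectations are zero, whereas its
  expectation under the limit is positive.\<close>

lemma hj_limit_spt_subset_closed:
  assumes M: "prob_space M" and N: "prob_space N" and G: "G \<in> borel_measurable N"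
    and conv: "hj_converges D M X N G"
    and T: "closed T" "\<And>n w. w \<in> space M \<Longrightarrow> X n w \<in> T"
  shows "spt N G \<subseteq> T"
proof
  interpret N: prob_space N by fact
  note [measurable] = G
  interpret Q: prob_space "distr N borel G" by (rule N.prob_space_distr) simp
  fix x assume x: "x \<in> spt N G"
  show "x \<in> T"
  proof (rule ccontr)
    assume "x \<notin> T"
    then obtain r where r: "r > 0" "ball x r \<subseteq> - T"
      using T(1) open_contains_ball[of "- T"] by (auto simp: open_Compl)
    have b01: "\<bar>bump x r z\<bar> \<le> 1" for z using bump_nonneg[of x r z] bump_le_1[OF r(1), of x z] by simp
    have zero: "bump x r (X n w) = 0" if "w \<in> space M" for n w
      using bump_eq_0[OF r(1), of "X n w" x] r(2) T(2)[OF that] by blast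
    have [measurable]: "bump x r \<in> borel_measurable borel"
      by (intro borel_measurable_continuous_onI continuous_intros)
    have "(\<lambda>n. outer_expectation M (\<lambda>w. bump x r (X n w))) \<longlonglongrightarrow> (\<integral>v. bump x r (G v) \<partial>N)"
      using conv b01 by (auto simp: hj_converges_def bounded_iff intro!: continuous_on_bump)
    then have "(\<integral>v. bump x r (G v) \<partial>N) = 0"
      using outer_expectation_zero[OF M zero] by (simp add: LIMSEQ_const_iff)
    moreover have int: "integrable N (\<lambda>v. bump x r (G v))"
      by (rule N.integrable_const_bound[where B = 1]) (use b01 in auto)
    moreover have "measure (distr N borel G) (ball x (r / 2)) / 2 \<le> (\<integral>v. bump x r (G v) \<partial>N)"
    proof -
      have "(\<integral>z. indicat_real (ball x (r / 2)) z \<partial>distr N borel G) =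
          (\<integral>v. indicat_real (ball x (r / 2)) (G v) \<partial>N)"
        by (rule integral_distr) (auto intro!: borel_measurable_indicator borel_open)
      then have "measure (distr N borel G) (ball x (r / 2)) / 2 = (\<integral>v. 1/2 * indicator (ball x (r / 2)) (G v) \<partial>N)"
        by simp
      also have "\<dots> \<le> (\<integral>v. bump x r (G v) \<partial>N)"
      proof (rule integral_mono[OF _ int])
        show "integrable N (\<lambda>v. 1/2 * indicat_real (ball x (r / 2)) (G v))"
        proof (rule N.integrable_const_bound[where B = 1])
          show "(\<lambda>v. 1/2 * indicat_real (ball x (r / 2)) (G v)) \<in> borel_measurable N"
            by (intro borel_measurable_times borel_measurable_const measurable_compose[OF G]
                borel_measurable_indicator) simp
        qed (simp add: indicator_def)
        show "1/2 * indicator (ball x (r / 2)) (G v) \<le> bump x r (G v)" for v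
          using bump_ge_half[OF r(1), of "G v" x] bump_nonneg[of x r "G v"] by (auto simp: indicator_def)
      qed
      finally show ?thesis .
    qed
    moreover have "emeasure (distr N borel G) (ball x (r / 2)) > 0"
      using x r(1) by (simp add: spt_def top_support_iff_ball)
    ultimately show False by (simp add: Q.emeasure_eq_measure)
  qed
qed

lemma closed_linf_on: "closed (linf_on I)"
proof -
  have "linf_on I = (\<Inter>i\<in>- I. {x. apply_bcontfun x (discrete i) = 0})"
    by (auto simp: linf_on_def)
  moreover have "closed {x::'a linf. apply_bcontfun x (discrete i) = 0}" for i
    by (intro closed_Collect_eq linear_continuous_on bounded_linear_apply_bcontfun continuous_on_const)
  ultimately show ?thesis by (simp add: closed_INT)
qed

section \<open>Integrals against mixtures\<close>

text \<open>The set function defining a mixture extends from indicators to all nonnegative measurable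
  functions by the usual induction.\<close>

lemma nn_integral_mixture:
  assumes \<mu>: "\<mu> \<in> borel_prob" and \<nu>: "\<nu> \<in> borel_prob" and f: "f \<in> borel_measurable borel"
  shows "(\<integral>\<^sup>+x. f x \<partial>mixture t \<mu> \<nu>) =
    ennreal (1 - t) * (\<integral>\<^sup>+x. f x \<partial>\<mu>) + ennreal t * (\<integral>\<^sup>+x. f x \<partial>\<nu>)"
proof -
  have sets [measurable_cong]: "sets \<mu> = sets borel" "sets \<nu> = sets borel" "sets (mixture t \<mu> \<nu>) = sets borel"
    using \<mu> \<nu> sets.sigma_sets_eq[of "borel :: 'a measure"]
    by (auto simp: borel_prob_def mixture_def)
  note space = sets_eq_imp_space_eq[OF sets(1)] sets_eq_imp_space_eq[OF sets(2)]
    sets_eq_imp_space_eq[OF sets(3)]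
  show ?thesis using f
  proof (induction rule: borel_measurable_induct)
    case (cong f g)
    then have "f = g" by auto
    then show ?case using cong by simp
  next
    case (set A)
    then show ?case by (simp add: sets emeasure_mixture[OF \<mu> \<nu>])
  next
    case (mult u c)
    note [measurable] = mult.hyps(2)
    show ?case by (simp add: nn_integral_cmult mult.IH distrib_left mult_ac)
  next
    case (add u v)
    note [measurable] = add.hyps(1,3)
    show ?case by (simp add: nn_integral_add add.IH distrib_left add_ac)
  next
    case (seq U)
    note [measurable] = seq.hyps(1)
    have inc: "incseq (\<lambda>i. c * (\<integral>\<^sup>+x. U i x \<partial>m))" for c m
      using seq.hyps(3) by (auto simp: incseq_def le_fun_def intro!: mult_left_mono nn_integral_mono)
    have SUP: "(\<integral>\<^sup>+x. (SUP i. U i) x \<partial>m) = (SUP i. \<integral>\<^sup>+x. U i x \<partial>m)" if "sets m = sets borel" for m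
      using nn_integral_monotone_convergence_SUP[OF seq.hyps(3), of m] that
      unfolding SUP_apply by (simp add: measurable_cong_sets[OF that refl])
    show ?case
      by (simp only: SUP sets seq.IH SUP_mult_left_ennreal ennreal_SUP_add[OF inc inc])
  qed
qed

lemma integral_mixture:
  fixes f :: "'s::topological_space \<Rightarrow> real"
  assumes \<mu>: "\<mu> \<in> borel_prob" and \<nu>: "\<nu> \<in> borel_prob" and t: "0 \<le> t" "t \<le> 1"
    and int: "integrable \<mu> f" "integrable \<nu> f"
  shows "(\<integral>x. f x \<partial>mixture t \<mu> \<nu>) = (1 - t) * (\<integral>x. f x \<partial>\<mu>) + t * (\<integral>x. f x \<partial>\<nu>)"
proof -
  have sets: "sets \<mu> = sets borel" "sets (mixture t \<mu> \<nu>) = sets borel"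
    using \<mu> sets.sigma_sets_eq[of "borel :: 's measure"] by (auto simp: borel_prob_def mixture_def)
  have f [measurable]: "f \<in> borel_measurable borel"
    using borel_measurable_integrable[OF int(1)] by (simp add: measurable_cong_sets[OF sets(1) refl])
  have fin: "(\<integral>\<^sup>+x. ennreal (f x) \<partial>\<mu>) < top" "(\<integral>\<^sup>+x. ennreal (- f x) \<partial>\<mu>) < top"
    "(\<integral>\<^sup>+x. ennreal (f x) \<partial>\<nu>) < top" "(\<integral>\<^sup>+x. ennreal (- f x) \<partial>\<nu>) < top"
    using int by (auto simp: real_integrable_def less_top[symmetric])
  have mix: "(\<integral>\<^sup>+x. ennreal (g x) \<partial>mixture t \<mu> \<nu>) =
      ennreal (1 - t) * (\<integral>\<^sup>+x. ennreal (g x) \<partial>\<mu>) + ennreal t * (\<integral>\<^sup>+x. ennreal (g x) \<partial>\<nu>)"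
    if "g \<in> borel_measurable borel" for g :: "'s \<Rightarrow> real"
    using that by (intro nn_integral_mixture[OF \<mu> \<nu>]) simp
  have "integrable (mixture t \<mu> \<nu>) f"
    using fin by (simp add: real_integrable_def less_top mix ennreal_mult_eq_top_iff measurable_cong_sets[OF sets(2) refl])
  then show ?thesis
    using fin t
    by (simp add: real_lebesgue_integral_def int mix enn2real_plus enn2real_mult ennreal_mult_less_top algebra_simps)
qed

section \<open>Right derivatives of locally Lipschitz functionals of a measure\<close>

locale lipschitz_right_differentiable =
  fixes \<F> :: "('s::topological_space \<Rightarrow> real) set" and F :: "'s \<Rightarrow> real"
    and P0 :: "'s measure set" and \<mu> :: "'s measure"
    and \<delta> :: "'s measure \<Rightarrow> 'e::banach" and \<epsilon> C :: real
  assumes F_meas: "\<F> \<subseteq> borel_measurable borel"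
    and env: "envelope \<F> F"
    and P0_prob: "P0 \<subseteq> borel_prob"
    and P0_convex: "convex_measures P0"
    and mu: "\<mu> \<in> P0"
    and P0_env: "\<forall>\<nu>\<in>P0. integrable \<nu> F"
    and eps: "\<epsilon> > 0"
    and lipschitz: "locally_lipschitz_at \<F> P0 \<delta> \<mu> \<epsilon> C"
    and right_diff: "\<forall>\<nu>\<in>P0. \<exists>d. has_right_derivative \<delta> \<mu> \<nu> d"
begin

abbreviation direction :: "'s measure \<Rightarrow> ('s \<Rightarrow> real) linf" where
  "direction \<nu> \<equiv> emb \<F> \<nu> - emb \<F> \<mu>"

abbreviation "U \<equiv> P0_ball \<F> P0 \<mu> \<epsilon>"

text \<open>The cone of scaled directions into \<open>P0\<close>, whose closure is the tangent cone. An element may arise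
  from many pairs \<open>(t, \<nu>)\<close>, so a map given by a formula in \<open>t\<close> and \<open>\<nu>\<close> is well defined here only if its
  value does not depend on the pair.\<close>

definition "rays = {t *\<^sub>R direction \<nu> | t \<nu>. \<nu> \<in> P0 \<and> t > 0}"

lemma tangent_cone_eq: "tangent_cone \<F> P0 \<mu> = closure rays"
  by (simp add: tangent_cone_def rays_def)

lemma raysI: "\<nu> \<in> P0 \<Longrightarrow> t > 0 \<Longrightarrow> t *\<^sub>R direction \<nu> \<in> rays"
  by (auto simp: rays_def)

lemma scale_rays: "x \<in> rays \<Longrightarrow> t > 0 \<Longrightarrow> t *\<^sub>R x \<in> rays"
  unfolding rays_def by clarsimp (metis mult_pos_pos)

lemma mixture_in_P0: "\<nu> \<in> P0 \<Longrightarrow> 0 \<le> t \<Longrightarrow> t \<le> 1 \<Longrightarrow> mixture t \<mu> \<nu> \<in> P0"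
  using P0_convex mu by (auto simp: convex_measures_def)

lemma integrable_class:
  assumes "\<nu> \<in> P0" "f \<in> \<F>" shows "integrable \<nu> f"
proof (rule Bochner_Integration.integrable_bound)
  show "integrable \<nu> F" using P0_env assms by blast
  have "sets \<nu> = sets borel" using P0_prob assms by (auto simp: borel_prob_def)
  then show "f \<in> borel_measurable \<nu>"
    using F_meas assms(2) measurable_cong_sets[of \<nu> borel borel borel] by auto
  show "AE x in \<nu>. norm (f x) \<le> norm (F x)"
    using env assms(2) by (intro AE_I2) (fastforce simp: envelope_def)
qed

text \<open>Segments of measures are mapped to segments of bounded functions: this is what ties right
  derivatives along mixtures to the norm of bounded functions.\<close>

lemma emb_mixture:
  assumes \<nu>: "\<nu> \<in> P0" and t: "0 \<le> t" "t \<le> 1"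
  shows "emb \<F> (mixture t \<mu> \<nu>) = emb \<F> \<mu> + t *\<^sub>R direction \<nu>"
proof (rule bcontfun_eqI)
  fix d :: "('s \<Rightarrow> real) discrete"
  define f where "f = of_discrete d"
  have d: "d = discrete f" by (simp add: f_def of_discrete_inverse)
  have app: "apply_bcontfun (emb \<F> \<rho>) (discrete f) = (if f \<in> \<F> then \<integral>x. f x \<partial>\<rho> else 0)" if "\<rho> \<in> P0" for \<rho>
    using that P0_prob P0_env by (intro emb_apply[OF _ F_meas env]) auto
  have "(\<integral>x. f x \<partial>mixture t \<mu> \<nu>) = (1 - t) * (\<integral>x. f x \<partial>\<mu>) + t * (\<integral>x. f x \<partial>\<nu>)" if "f \<in> \<F>"
    using mu \<nu> P0_prob that by (intro integral_mixture t integrable_class) auto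
  then show "apply_bcontfun (emb \<F> (mixture t \<mu> \<nu>)) d = apply_bcontfun (emb \<F> \<mu> + t *\<^sub>R direction \<nu>) d"
    by (simp add: d app mu \<nu> mixture_in_P0[OF \<nu> t] algebra_simps)
qed

lemma mu_in_ball: "\<mu> \<in> U"
  using mu eps by (simp add: P0_ball_def)

lemma delta_lipschitz:
  assumes "\<nu> \<in> U" "\<nu>' \<in> U"
  shows "norm (\<delta> \<nu> - \<delta> \<nu>') \<le> \<bar>C\<bar> * norm (emb \<F> \<nu> - emb \<F> \<nu>')"
proof -
  have "norm (\<delta> \<nu> - \<delta> \<nu>') \<le> C * norm (emb \<F> \<nu> - emb \<F> \<nu>')"
    using assms lipschitz by (auto simp: locally_lipschitz_at_def P0_ball_def)
  also have "\<dots> \<le> \<bar>C\<bar> * norm (emb \<F> \<nu> - emb \<F> \<nu>')" by (intro mult_right_mono) auto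
  finally show ?thesis .
qed

lemma eventually_mixture_in_ball:
  assumes \<nu>: "\<nu> \<in> P0" and s: "s > 0"
  shows "eventually (\<lambda>t. 0 < t \<and> mixture (t * s) \<mu> \<nu> \<in> U \<and>
    emb \<F> (mixture (t * s) \<mu> \<nu>) = emb \<F> \<mu> + t *\<^sub>R s *\<^sub>R direction \<nu>) (at_right 0)"
proof -
  have "((\<lambda>t. t * s) \<longlongrightarrow> 0 * s) (at_right 0)" by (intro tendsto_intros)
  then have 1: "eventually (\<lambda>t. t * s < 1) (at_right 0)"
    by (intro order_tendstoD(2)[of _ "0 * s"]) auto
  have "((\<lambda>t. t * (s * norm (direction \<nu>))) \<longlongrightarrow> 0 * (s * norm (direction \<nu>))) (at_right 0)"
    by (intro tendsto_intros)
  then have 2: "eventually (\<lambda>t. t * (s * norm (direction \<nu>)) < \<epsilon>) (at_right 0)"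
    using eps by (intro order_tendstoD(2)[of _ "0 * (s * norm (direction \<nu>))"]) auto
  have 3: "eventually (\<lambda>t::real. 0 < t) (at_right 0)" by (simp add: eventually_at_right_less)
  show ?thesis
    using 1 2 3
  proof eventually_elim
    case (elim t)
    then have ts: "0 \<le> t * s" "t * s \<le> 1" using s by auto
    from emb_mixture[OF \<nu> ts] mixture_in_P0[OF \<nu> ts] elim s show ?case
      by (simp add: P0_ball_def mult.assoc)
  qed
qed

lemma scaled_right_derivative:
  assumes d: "has_right_derivative \<delta> \<mu> \<nu> d" and s: "s > 0"
  shows "((\<lambda>t. (1 / t) *\<^sub>R (\<delta> (mixture (t * s) \<mu> \<nu>) - \<delta> \<mu>)) \<longlongrightarrow> s *\<^sub>R d) (at_right 0)"
proof -
  have "filterlim (\<lambda>t. t * s) (at_right 0) (at_right 0)"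
  proof (rule filterlim_at_withinI)
    have "((\<lambda>t. t * s) \<longlongrightarrow> 0 * s) (at_right 0)" by (intro tendsto_intros)
    then show "filterlim (\<lambda>t. t * s) (nhds 0) (at_right 0)" by simp
    show "\<forall>\<^sub>F t in at_right 0. t * s \<in> {0<..} - {0}"
      using eventually_at_right_less[of 0] by eventually_elim (use s in auto)
  qed
  from filterlim_compose[OF d[unfolded has_right_derivative_def] this]
  have "((\<lambda>t. s *\<^sub>R (1 / (t * s)) *\<^sub>R (\<delta> (mixture (t * s) \<mu> \<nu>) - \<delta> \<mu>)) \<longlongrightarrow> s *\<^sub>R d) (at_right 0)"
    by (intro tendsto_scaleR tendsto_const)
  then show ?thesis using s by simp
qed

text \<open>Passage to the limit in the Lipschitz bound for difference quotients. The case where the right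
  hand side vanishes says that the derivative depends only on the direction as a bounded function.\<close>

lemma right_derivative_lipschitz:
  assumes \<nu>: "\<nu> \<in> P0" "has_right_derivative \<delta> \<mu> \<nu> d" "s > 0"
    and \<nu>': "\<nu>' \<in> P0" "has_right_derivative \<delta> \<mu> \<nu>' d'" "s' > 0"
  shows "norm (s *\<^sub>R d - s' *\<^sub>R d') \<le> \<bar>C\<bar> * norm (s *\<^sub>R direction \<nu> - s' *\<^sub>R direction \<nu>')"
proof (rule tendsto_upperbound)
  show "((\<lambda>t. norm ((1 / t) *\<^sub>R (\<delta> (mixture (t * s) \<mu> \<nu>) - \<delta> \<mu>)
      - (1 / t) *\<^sub>R (\<delta> (mixture (t * s') \<mu> \<nu>') - \<delta> \<mu>))) \<longlongrightarrow> norm (s *\<^sub>R d - s' *\<^sub>R d')) (at_right 0)"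
    by (intro tendsto_norm tendsto_diff scaled_right_derivative assms)
  show "eventually (\<lambda>t. norm ((1 / t) *\<^sub>R (\<delta> (mixture (t * s) \<mu> \<nu>) - \<delta> \<mu>)
      - (1 / t) *\<^sub>R (\<delta> (mixture (t * s') \<mu> \<nu>') - \<delta> \<mu>))
      \<le> \<bar>C\<bar> * norm (s *\<^sub>R direction \<nu> - s' *\<^sub>R direction \<nu>')) (at_right 0)"
    using eventually_mixture_in_ball[OF \<nu>(1,3)] eventually_mixture_in_ball[OF \<nu>'(1,3)]
  proof eventually_elim
    case (elim t)
    have "norm ((1 / t) *\<^sub>R (\<delta> (mixture (t * s) \<mu> \<nu>) - \<delta> \<mu>)
        - (1 / t) *\<^sub>R (\<delta> (mixture (t * s') \<mu> \<nu>') - \<delta> \<mu>))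
      = (1 / t) * norm (\<delta> (mixture (t * s) \<mu> \<nu>) - \<delta> (mixture (t * s') \<mu> \<nu>'))"
      using elim by (simp add: scaleR_diff_right[symmetric] del: scaleR_diff_right)
    also have "\<dots> \<le> (1 / t) * (\<bar>C\<bar> * norm (emb \<F> (mixture (t * s) \<mu> \<nu>) - emb \<F> (mixture (t * s') \<mu> \<nu>')))"
      using elim by (intro mult_left_mono delta_lipschitz) auto
    also have "emb \<F> (mixture (t * s) \<mu> \<nu>) - emb \<F> (mixture (t * s') \<mu> \<nu>')
        = t *\<^sub>R (s *\<^sub>R direction \<nu> - s' *\<^sub>R direction \<nu>')"
      using elim by (simp add: scaleR_diff_right)
    also have "(1 / t) * (\<bar>C\<bar> * norm (t *\<^sub>R (s *\<^sub>R direction \<nu> - s' *\<^sub>R direction \<nu>')))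
        = \<bar>C\<bar> * norm (s *\<^sub>R direction \<nu> - s' *\<^sub>R direction \<nu>')"
      using elim by simp
    finally show ?case .
  qed
qed simp

text \<open>The derivative is well defined and Lipschitz on the rays, hence extends to their closure
  because the target space is complete; homogeneity passes to the closure by continuity.\<close>

lemma is_derivative_extension_exists: "\<exists>D. is_derivative_extension \<F> P0 \<delta> \<mu> D"
proof -
  obtain d where d: "\<And>\<nu>. \<nu> \<in> P0 \<Longrightarrow> has_right_derivative \<delta> \<mu> \<nu> (d \<nu>)"
    using right_diff by metis
  have "\<forall>x\<in>rays. \<exists>s \<nu>. \<nu> \<in> P0 \<and> s > 0 \<and> x = s *\<^sub>R direction \<nu>"
    unfolding rays_def by blast
  then obtain s \<rho> where rep: "\<And>x. x \<in> rays \<Longrightarrow> \<rho> x \<in> P0 \<and> s x > 0 \<and> x = s x *\<^sub>R direction (\<rho> x)"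
    by metis
  define D0 where "D0 x = s x *\<^sub>R d (\<rho> x)" for x
  have D0: "D0 (t *\<^sub>R direction \<nu>) = t *\<^sub>R d \<nu>" if "\<nu> \<in> P0" "t > 0" for t \<nu>
  proof -
    let ?x = "t *\<^sub>R direction \<nu>"
    note x = rep[OF raysI[OF that]]
    have "norm (s ?x *\<^sub>R d (\<rho> ?x) - t *\<^sub>R d \<nu>) \<le> \<bar>C\<bar> * norm (s ?x *\<^sub>R direction (\<rho> ?x) - t *\<^sub>R direction \<nu>)"
      using x that by (intro right_derivative_lipschitz d) auto
    also have "\<dots> = 0" using x by simp
    finally show ?thesis by (simp add: D0_def)
  qed
  have "\<bar>C\<bar>-lipschitz_on rays D0"
  proof (rule lipschitz_onI)
    fix x y assume x: "x \<in> rays" and y: "y \<in> rays"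
    have "norm (s x *\<^sub>R d (\<rho> x) - s y *\<^sub>R d (\<rho> y)) \<le> \<bar>C\<bar> * norm (s x *\<^sub>R direction (\<rho> x) - s y *\<^sub>R direction (\<rho> y))"
      using rep[OF x] rep[OF y] by (intro right_derivative_lipschitz d) auto
    then show "dist (D0 x) (D0 y) \<le> \<bar>C\<bar> * dist x y"
      using rep[OF x] rep[OF y] by (simp add: D0_def dist_norm)
  qed simp
  then obtain g where g: "\<bar>C\<bar>-lipschitz_on (closure rays) g" "\<And>x. x \<in> rays \<Longrightarrow> g x = D0 x"
    using lipschitz_extend_closure by blast
  have cont: "continuous_on (closure rays) g" using g(1) by (rule lipschitz_on_continuous_on)
  have homog: "t *\<^sub>R x \<in> closure rays \<and> g (t *\<^sub>R x) = t *\<^sub>R g x" if x: "x \<in> closure rays" and t: "t > 0" for t x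
  proof -
    obtain a where a: "\<And>n. a n \<in> rays" "a \<longlonglongrightarrow> x" using x by (auto simp: closure_sequential)
    have ta: "(\<lambda>n. t *\<^sub>R a n) \<longlonglongrightarrow> t *\<^sub>R x" by (intro tendsto_intros a)
    then have tx: "t *\<^sub>R x \<in> closure rays"
      unfolding closure_sequential using scale_rays[OF a(1) t] by (intro exI[of _ "\<lambda>n. t *\<^sub>R a n"]) simp
    have inC: "a n \<in> closure rays" "t *\<^sub>R a n \<in> closure rays" for n
      using a(1) scale_rays[OF a(1) t] closure_subset by blast+
    have "(\<lambda>n. g (t *\<^sub>R a n)) \<longlonglongrightarrow> g (t *\<^sub>R x)"
      by (intro continuous_on_tendsto_compose[OF cont ta tx] always_eventually allI inC)
    moreover have "(\<lambda>n. t *\<^sub>R g (a n)) \<longlonglongrightarrow> t *\<^sub>R g x"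
      by (intro tendsto_scaleR tendsto_const continuous_on_tendsto_compose[OF cont a(2) x]
          always_eventually allI inC)
    moreover have "g (t *\<^sub>R a n) = t *\<^sub>R g (a n)" for n
    proof -
      have r: "\<rho> (a n) \<in> P0" "s (a n) > 0" "a n = s (a n) *\<^sub>R direction (\<rho> (a n))" using rep[OF a(1)] by auto
      have "g (t *\<^sub>R a n) = D0 ((t * s (a n)) *\<^sub>R direction (\<rho> (a n)))"
        using g(2)[OF scale_rays[OF a(1) t]] r(3) by (metis scaleR_scaleR)
      also have "\<dots> = t *\<^sub>R D0 (a n)" using r t by (subst D0) (auto simp: D0_def)
      finally show ?thesis using g(2)[OF a(1)] by simp
    qed
    ultimately show ?thesis using tx by (simp add: LIMSEQ_unique)
  qed
  have "is_derivative_extension \<F> P0 \<delta> \<mu> (restrict g (closure rays))"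
    unfolding is_derivative_extension_def tangent_cone_eq
  proof (intro conjI ballI allI impI)
    show "continuous_on (closure rays) (restrict g (closure rays))"
      using cont by (rule continuous_on_eq) simp
    show "has_right_derivative \<delta> \<mu> \<nu> (restrict g (closure rays) (direction \<nu>))" if "\<nu> \<in> P0" for \<nu>
      using d[OF that] raysI[OF that, of 1] D0[OF that, of 1] g(2)[of "direction \<nu>"]
        closure_subset[of rays] by auto
  qed (use homog in auto)
  then show ?thesis by blast
qed

text \<open>On the rays, uniqueness of the limit of difference quotients and homogeneity fix the values;
  continuity fixes them on the closure.\<close>

lemma is_derivative_extension_unique:
  assumes D: "is_derivative_extension \<F> P0 \<delta> \<mu> D" and D': "is_derivative_extension \<F> P0 \<delta> \<mu> D'"
  shows "D = D'"
proof (rule extensionalityI)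
  show "D \<in> extensional (closure rays)" "D' \<in> extensional (closure rays)"
    using assms by (auto simp: is_derivative_extension_def tangent_cone_eq)
  have agree: "D x = D' x" if ray: "x \<in> rays" for x
  proof -
    obtain t \<nu> where x: "x = t *\<^sub>R direction \<nu>" "\<nu> \<in> P0" "t > 0" using ray by (auto simp: rays_def)
    have dir: "direction \<nu> \<in> closure rays" using raysI[OF x(2), of 1] closure_subset by auto
    have "D (direction \<nu>) = D' (direction \<nu>)"
    proof (rule tendsto_unique[OF trivial_limit_at_right_real])
      show "((\<lambda>t. (1 / t) *\<^sub>R (\<delta> (mixture t \<mu> \<nu>) - \<delta> \<mu>)) \<longlongrightarrow> D (direction \<nu>)) (at_right 0)"
        "((\<lambda>t. (1 / t) *\<^sub>R (\<delta> (mixture t \<mu> \<nu>) - \<delta> \<mu>)) \<longlongrightarrow> D' (direction \<nu>)) (at_right 0)"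
        using assms x(2) by (auto simp: is_derivative_extension_def has_right_derivative_def)
    qed
    then show ?thesis
      using assms x dir by (auto simp: is_derivative_extension_def tangent_cone_eq)
  qed
  fix x assume x: "x \<in> closure rays"
  then obtain a where a: "\<And>n. a n \<in> rays" "a \<longlonglongrightarrow> x" by (auto simp: closure_sequential)
  have inC: "a n \<in> closure rays" for n using a(1) closure_subset by blast
  have "continuous_on (closure rays) D" "continuous_on (closure rays) D'"
    using assms by (auto simp: is_derivative_extension_def tangent_cone_eq)
  then have "(\<lambda>n. D (a n)) \<longlonglongrightarrow> D x" "(\<lambda>n. D' (a n)) \<longlonglongrightarrow> D' x"
    by (auto intro: continuous_on_tendsto_compose[OF _ a(2) x] always_eventually inC)
  then show "D x = D' x" by (simp add: agree[OF a(1)] LIMSEQ_unique)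
qed

abbreviation "D \<equiv> derivative_extension \<F> P0 \<delta> \<mu>"

lemma derivative_extension: "is_derivative_extension \<F> P0 \<delta> \<mu> D"
  unfolding derivative_extension_def
  by (rule theI'[of "is_derivative_extension \<F> P0 \<delta> \<mu>"]) (use is_derivative_extension_exists is_derivative_extension_unique in blast)

text \<open>Approximate \<open>h\<close> by a ray \<open>x = s (\<nu> - \<mu>)\<close>. The measure represented by \<open>\<mu> + t k\<close> is compared with the
  mixture representing \<open>\<mu> + t x\<close>: by the Lipschitz property the difference quotients differ by at most
  \<open>\<bar>C\<bar> \<parallel>k - x\<parallel>\<close>, and the quotient along the mixture tends to \<open>D x\<close>, which is close to \<open>D h\<close>.
  The bounds hold uniformly in \<open>t\<close> and \<open>k\<close>, so that sequences of mixed sign can be treated later.\<close>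

lemma one_sided_hadamard:
  assumes h: "h \<in> tangent_cone \<F> P0 \<mu>" and e: "e > 0"
  shows "\<exists>r>0. \<forall>t k. 0 < t \<longrightarrow> t < r \<longrightarrow> norm (k - h) < r \<longrightarrow> emb \<F> \<mu> + t *\<^sub>R k \<in> emb \<F> ` U \<longrightarrow>
    norm ((1 / t) *\<^sub>R (delta_bar \<F> P0 \<mu> \<epsilon> \<delta> (emb \<F> \<mu> + t *\<^sub>R k) - delta_bar \<F> P0 \<mu> \<epsilon> \<delta> (emb \<F> \<mu>)) - D h) < e"
proof -
  note ext = derivative_extension[unfolded is_derivative_extension_def tangent_cone_eq]
  note h = h[unfolded tangent_cone_eq]
  \<comment> \<open>The error budget is \<open>e / 2\<close> for the Lipschitz comparison, whose two distances \<open>k - h\<close> and \<open>h - x\<close>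
    are each below \<open>\<eta>\<close>, and \<open>e / 4\<close> each for the limit along the mixture and the continuity of \<open>D\<close>.\<close>
  define \<eta> where "\<eta> = e / (4 * (\<bar>C\<bar> + 1))"
  have \<eta>: "\<eta> > 0" "2 * \<bar>C\<bar> * \<eta> < e / 2" using e by (auto simp: \<eta>_def field_simps)
  obtain \<rho> where \<rho>: "\<rho> > 0" "\<And>x. x \<in> closure rays \<Longrightarrow> dist x h < \<rho> \<Longrightarrow> dist (D x) (D h) < e / 4"
    using ext h e unfolding continuous_on_iff by (metis zero_less_divide_iff zero_less_numeral)
  obtain x where x: "x \<in> rays" "dist x h < min \<rho> \<eta>"
    using h \<rho>(1) \<eta>(1) unfolding closure_approachable by (metis min_less_iff_conj)
  then obtain s \<nu> where s: "x = s *\<^sub>R direction \<nu>" "\<nu> \<in> P0" "s > 0" by (auto simp: rays_def)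
  have dir: "direction \<nu> \<in> closure rays" using raysI[OF s(2), of 1] closure_subset by auto
  have Dx: "D x = s *\<^sub>R D (direction \<nu>)" using ext s dir by auto
  have lim: "((\<lambda>t. (1 / t) *\<^sub>R (\<delta> (mixture (t * s) \<mu> \<nu>) - \<delta> \<mu>)) \<longlongrightarrow> D x) (at_right 0)"
    unfolding Dx using ext s by (intro scaled_right_derivative) auto
  have "eventually (\<lambda>t. (0 < t \<and> mixture (t * s) \<mu> \<nu> \<in> U \<and>
      emb \<F> (mixture (t * s) \<mu> \<nu>) = emb \<F> \<mu> + t *\<^sub>R x) \<and>
      dist ((1 / t) *\<^sub>R (\<delta> (mixture (t * s) \<mu> \<nu>) - \<delta> \<mu>)) (D x) < e / 4) (at_right 0)"
    using e by (intro eventually_conj eventually_mixture_in_ball[OF s(2,3), folded s(1)] tendstoD[OF lim]) simp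
  then obtain r0 where r0: "r0 > 0" "\<And>t. 0 < t \<Longrightarrow> t < r0 \<Longrightarrow> mixture (t * s) \<mu> \<nu> \<in> U \<and>
      emb \<F> (mixture (t * s) \<mu> \<nu>) = emb \<F> \<mu> + t *\<^sub>R x \<and>
      dist ((1 / t) *\<^sub>R (\<delta> (mixture (t * s) \<mu> \<nu>) - \<delta> \<mu>)) (D x) < e / 4"
    unfolding eventually_at_right_field by auto
  show ?thesis
  proof (intro exI[of _ "min r0 \<eta>"] conjI allI impI)
    show "min r0 \<eta> > 0" using r0(1) \<eta>(1) by simp
    fix t k assume t: "0 < t" "t < min r0 \<eta>" and k: "norm (k - h) < min r0 \<eta>"
      and "emb \<F> \<mu> + t *\<^sub>R k \<in> emb \<F> ` U"
    then obtain \<nu>' where \<nu>': "\<nu>' \<in> U" "emb \<F> \<mu> + t *\<^sub>R k = emb \<F> \<nu>'" by auto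
    let ?m = "mixture (t * s) \<mu> \<nu>"
    have m: "?m \<in> U" "emb \<F> ?m = emb \<F> \<mu> + t *\<^sub>R x"
      "dist ((1 / t) *\<^sub>R (\<delta> ?m - \<delta> \<mu>)) (D x) < e / 4" using r0(2)[of t] t by auto
    have bar: "delta_bar \<F> P0 \<mu> \<epsilon> \<delta> (emb \<F> \<mu> + t *\<^sub>R k) = \<delta> \<nu>'" "delta_bar \<F> P0 \<mu> \<epsilon> \<delta> (emb \<F> \<mu>) = \<delta> \<mu>"
      using delta_bar_emb[OF lipschitz] \<nu>' mu_in_ball by auto
    have "norm (\<delta> \<nu>' - \<delta> ?m) \<le> \<bar>C\<bar> * norm (emb \<F> \<nu>' - emb \<F> ?m)"
      by (rule delta_lipschitz[OF \<nu>'(1) m(1)])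
    also have "emb \<F> \<nu>' - emb \<F> ?m = t *\<^sub>R (k - x)"
      unfolding m(2) \<nu>'(2)[symmetric] by (simp add: scaleR_diff_right)
    also have "\<bar>C\<bar> * norm (t *\<^sub>R (k - x)) = t * (\<bar>C\<bar> * norm (k - x))" using t by simp
    finally have "norm ((1 / t) *\<^sub>R (\<delta> \<nu>' - \<delta> ?m)) \<le> \<bar>C\<bar> * norm (k - x)"
      unfolding norm_scaleR using t by (simp add: pos_divide_le_eq mult.commute)
    also have "\<dots> \<le> \<bar>C\<bar> * (2 * \<eta>)"
    proof (rule mult_left_mono)
      have "norm (k - x) \<le> norm (k - h) + dist x h"
        using dist_triangle[of k x h] by (simp add: dist_norm norm_minus_commute)
      then show "norm (k - x) \<le> 2 * \<eta>" using k x(2) by simp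
    qed simp
    also have "\<dots> < e / 2" using \<eta>(2) by simp
    finally have 1: "norm ((1 / t) *\<^sub>R (\<delta> \<nu>' - \<delta> ?m)) < e / 2" .
    have 2: "norm ((1 / t) *\<^sub>R (\<delta> ?m - \<delta> \<mu>) - D x) < e / 4" using m(3) by (simp add: dist_norm)
    have 3: "norm (D x - D h) < e / 4"
      using \<rho>(2)[of x] x closure_subset by (auto simp: dist_norm)
    have "(1 / t) *\<^sub>R (\<delta> \<nu>' - \<delta> \<mu>) - D h =
      (1 / t) *\<^sub>R (\<delta> \<nu>' - \<delta> ?m) + ((1 / t) *\<^sub>R (\<delta> ?m - \<delta> \<mu>) - D x) + (D x - D h)"
      by (simp add: scaleR_diff_right)
    then have "norm ((1 / t) *\<^sub>R (\<delta> \<nu>' - \<delta> \<mu>) - D h) < e"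
      using norm_add_less[OF norm_add_less[OF 1 2] 3] by simp
    then show "norm ((1 / t) *\<^sub>R (delta_bar \<F> P0 \<mu> \<epsilon> \<delta> (emb \<F> \<mu> + t *\<^sub>R k) - delta_bar \<F> P0 \<mu> \<epsilon> \<delta> (emb \<F> \<mu>)) - D h) < e"
      by (simp only: bar)
  qed
qed

text \<open>Where \<open>t n\<close> is negative, write \<open>t h = (- t) (- h)\<close> and apply the one-sided statement to \<open>- h\<close>, which
  again lies in the tangent cone; linearity gives \<open>D (- h) = - D h\<close>, so both signs lead to the
  same limit.\<close>

theorem hadamard_differentiable_if_linear:
  assumes V: "subspace V" "V \<subseteq> tangent_cone \<F> P0 \<mu>" and lin: "linear_on_subspace V D"
  shows "hadamard_differentiable (delta_bar \<F> P0 \<mu> \<epsilon> \<delta>) (emb \<F> ` U) (emb \<F> \<mu>) V"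
  unfolding hadamard_differentiable_def
proof (intro conjI exI[of _ D] ballI allI impI)
  show "emb \<F> \<mu> \<in> emb \<F> ` U" using mu_in_ball by blast
  show "continuous_on V D"
    using derivative_extension V(2) continuous_on_subset by (auto simp: is_derivative_extension_def)
  fix h t hs
  assume h: "h \<in> V" and "t \<longlonglongrightarrow> 0 \<and> (\<forall>n. t n \<noteq> 0) \<and> hs \<longlonglongrightarrow> h \<and> (\<forall>n. emb \<F> \<mu> + t n *\<^sub>R hs n \<in> emb \<F> ` U)"
  then have t: "t \<longlonglongrightarrow> 0" "\<And>n. t n \<noteq> 0" and hs: "hs \<longlonglongrightarrow> h" "\<And>n. emb \<F> \<mu> + t n *\<^sub>R hs n \<in> emb \<F> ` U"
    by auto
  let ?b = "delta_bar \<F> P0 \<mu> \<epsilon> \<delta>"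
  have neg: "- h \<in> V" "D (- h) = - D h"
    using subspace_neg[OF V(1) h] lin h unfolding linear_on_subspace_def
    by (auto dest: spec[where x = "-1"])
  show "(\<lambda>n. (1 / t n) *\<^sub>R (?b (emb \<F> \<mu> + t n *\<^sub>R hs n) - ?b (emb \<F> \<mu>))) \<longlonglongrightarrow> D h"
  proof (rule tendstoI)
    fix e :: real assume e: "e > 0"
    have "h \<in> tangent_cone \<F> P0 \<mu>" "- h \<in> tangent_cone \<F> P0 \<mu>" using h neg V by auto
    from one_sided_hadamard[OF this(1) e] one_sided_hadamard[OF this(2) e]
    obtain r r' where r: "r > 0" "\<And>t k. 0 < t \<Longrightarrow> t < r \<Longrightarrow> norm (k - h) < r \<Longrightarrow> emb \<F> \<mu> + t *\<^sub>R k \<in> emb \<F> ` U \<Longrightarrow>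
        norm ((1 / t) *\<^sub>R (?b (emb \<F> \<mu> + t *\<^sub>R k) - ?b (emb \<F> \<mu>)) - D h) < e"
      and r': "r' > 0" "\<And>t k. 0 < t \<Longrightarrow> t < r' \<Longrightarrow> norm (k - - h) < r' \<Longrightarrow> emb \<F> \<mu> + t *\<^sub>R k \<in> emb \<F> ` U \<Longrightarrow>
        norm ((1 / t) *\<^sub>R (?b (emb \<F> \<mu> + t *\<^sub>R k) - ?b (emb \<F> \<mu>)) - D (- h)) < e"
      by metis
    have "min r r' > 0" using r(1) r'(1) by simp
    from tendstoD[OF t(1) this] tendstoD[OF hs(1) this]
    have "eventually (\<lambda>n. dist (t n) 0 < min r r') sequentially" "eventually (\<lambda>n. dist (hs n) h < min r r') sequentially"
      by blast+
    then show "eventually (\<lambda>n. dist ((1 / t n) *\<^sub>R (?b (emb \<F> \<mu> + t n *\<^sub>R hs n) - ?b (emb \<F> \<mu>))) (D h) < e) sequentially"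
    proof eventually_elim
      case (elim n)
      show ?case
      proof (cases "t n > 0")
        case True
        then show ?thesis using r(2)[of "t n" "hs n"] elim hs(2) by (simp add: dist_norm)
      next
        case False
        then have "- t n > 0" using t(2)[of n] by linarith
        moreover have "norm (- hs n - - h) < r'" using elim by (simp add: dist_norm norm_minus_commute)
        ultimately have "norm ((1 / - t n) *\<^sub>R (?b (emb \<F> \<mu> + (- t n) *\<^sub>R (- hs n)) - ?b (emb \<F> \<mu>)) - D (- h)) < e"
          using elim hs(2)[of n] by (intro r'(2)) auto
        then have "norm (- ((1 / t n) *\<^sub>R (?b (emb \<F> \<mu> + t n *\<^sub>R hs n) - ?b (emb \<F> \<mu>)) - D h)) < e"
          by (simp add: neg(2))
        then show ?thesis by (simp only: norm_minus_cancel dist_norm)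
      qed
    qed
  qed
qed (use V lin in auto)

end

theorem corollary1:
  fixes \<F> :: "('s::topological_space \<Rightarrow> real) set"
    and F :: "'s \<Rightarrow> real"
    and \<mu> :: "'s measure"
    and P0 :: "'s measure set"
    and \<delta> :: "'s measure \<Rightarrow> 'e::banach"
    and M :: "'w measure" and \<mu>n :: "nat \<Rightarrow> 'w \<Rightarrow> 's measure"
    and N :: "'v measure" and G :: "'v \<Rightarrow> ('s \<Rightarrow> real) linf"
    and \<epsilon> C :: real
  assumes F_meas: "\<F> \<subseteq> borel_measurable borel"
    and env: "envelope \<F> F"
    and P0_prob: "P0 \<subseteq> borel_prob"
    and P0_convex: "convex_measures P0"
    and mu: "\<mu> \<in> P0"
    and P0_env: "\<forall>\<nu>\<in>P0. integrable \<nu> F"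
    and M: "prob_space M"
    and N: "prob_space N"
    and mun: "\<forall>n. \<forall>w\<in>space M. \<mu>n n w \<in> P0"
    and G_linf: "\<forall>v\<in>space N. G v \<in> linf_on \<F>"
    and G_tight: "tight_rv N G"
    and conv: "hj_converges (linf_on \<F>) M
                 (\<lambda>n w. sqrt (real n) *\<^sub>R (emb \<F> (\<mu>n n w) - emb \<F> \<mu>)) N G"
    and eps: "\<epsilon> > 0"
    and lipschitz: "locally_lipschitz_at \<F> P0 \<delta> \<mu> \<epsilon> C"
    and right_diff: "\<forall>\<nu>\<in>P0. \<exists>d. has_right_derivative \<delta> \<mu> \<nu> d"
    and gauss: "centered_gaussian N G"
  shows "subspace (spt N G) \<and> spt N G \<subseteq> linf_on \<F> \<and>
         (linear_on_subspace (spt N G) (derivative_extension \<F> P0 \<delta> \<mu>) \<longrightarrow>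
            hadamard_differentiable (delta_bar \<F> P0 \<mu> \<epsilon> \<delta>) (emb \<F> ` P0_ball \<F> P0 \<mu> \<epsilon>)
              (emb \<F> \<mu>) (spt N G))"
proof -
  interpret lipschitz_right_differentiable \<F> F P0 \<mu> \<delta> \<epsilon> C
    by unfold_locales fact+
  have G: "G \<in> borel_measurable N" using gauss by (simp add: centered_gaussian_def)
  have sub: "subspace (spt N G)" by (rule subspace_spt_gaussian[OF N gauss G_tight])
  have "sqrt (real n) *\<^sub>R direction (\<mu>n n w) \<in> tangent_cone \<F> P0 \<mu>" if "w \<in> space M" for n w
  proof -
    \<comment> \<open>The factor \<open>sqrt 0\<close> yields the zero direction, which is the ray through \<open>\<mu>\<close> itself.\<close>
    have "0 \<in> rays" using raysI[OF mu, of 1] by simp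
    then have "sqrt (real n) *\<^sub>R direction (\<mu>n n w) \<in> rays"
      using raysI[of "\<mu>n n w" "sqrt (real n)"] mun that by (cases "n = 0") auto
    then show ?thesis using closure_subset unfolding tangent_cone_eq by blast
  qed
  then have "spt N G \<subseteq> tangent_cone \<F> P0 \<mu>"
    by (intro hj_limit_spt_subset_closed[OF M N G conv]) (auto simp: tangent_cone_def)
  moreover have "spt N G \<subseteq> linf_on \<F>"
    using G_linf by (intro spt_subset_closed[OF G closed_linf_on]) auto
  ultimately show ?thesis using sub hadamard_differentiable_if_linear by blast
qed

end
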